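(* Let $d\ge 1$ be an integer and $s>0$. There is a constant $c=c(d,s)>0$ depending only on $d$ and $s$ with the following property. Let $\eta$ be a nonnegative Borel measure on $\mathbb R^d$ such that $\eta\in\Sigma_s$, $\|\eta\|<\infty$, $R_\eta^s(x)$ exists for $\eta$-a.e. $x$, and $|\!|\!|\mathfrak R_\eta^s|\!|\!|\le 1$. (1) If $a>0$ and $$\|R_\eta^s\|_{L^2(\eta)}^2\ge a\|\eta\|,$$ then for every $b\in(0,a)$ $$\eta\{x:\ |R_\eta^s(x)|^2>b\}>c\,(a-b)^2\|\eta\|.$$ (2) Conversely, if $0<b<a$ and $\eta\{x: |R_\eta^s(x)|^2>b\}>c(a-b)^2\|\eta\|$, then $\|R_\eta^s\|_{L^2(\eta)}^2\ge b\,c\,(a-b)^2\|\eta\|$. The analogous statements, with $R_\eta^s$ replaced by the maximal transform $R_{\eta,\ast}^s$ in the two displayed inequalities of (1) and in the two inequalities of (2), also hold.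
   Context: $\Sigma_s$ is the class of nonnegative Borel measures $\eta$ on $\mathbb R^d$ with $\eta(B(x,r))\le r^s$ for all $x\in\mathbb R^d$, $r>0$, where $B(x,r)=\{y:|y-x|<r\}$. $\|\eta\|=\eta(\mathbb R^d)$. For a finite nonnegative Borel measure $\nu$ and $\varepsilon>0$, put $K^s(x)=x/|x|^{s+1}$ for $x\in\mathbb R^d\setminus\{0\}$ and $$R_{\nu,\varepsilon}^s(x)=\int_{|y-x|>\varepsilon}K^s(y-x)\,d\nu(y)\in\mathbb R^d .$$ $R_\nu^s(x)=\lim_{\varepsilon\to0+}R_{\nu,\varepsilon}^s(x)$ whenever the limit exists, and $R_{\nu,\ast}^s(x)=\sup_{\varepsilon>0}|R_{\nu,\varepsilon}^s(x)|$. For $f\in L^2(\nu)$, $\mathfrak R_{\nu,\varepsilon}^sf(x)=\int_{|y-x|>\varepsilon}K^s(y-x)f(y)\,d\nu(y)$, and $$|\!|\!|\mathfrak R_\nu^s|\!|\!|:=\sup_{\varepsilon>0}\|\mathfrak R_{\nu,\varepsilon}^s\|_{L^2(\nu)\to L^2(\nu)} .$$ The $L^2(\eta)$-norm of a vector-valued function is the $L^2(\eta)$-norm of its Euclidean length.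
   Formalization: In (1) and its maximal version the measure η is assumed nonzero (‖η‖ > 0); for η = 0 the hypotheses hold but the strict conclusion reads 0 > 0, so the statement fails there. *)

theory Defs
  imports "HOL-Analysis.Analysis"
begin

definition growth_class :: "real \<Rightarrow> 'a::euclidean_space measure set" where
  "growth_class s =
     {\<eta>. sets \<eta> = sets borel \<and> (\<forall>x. \<forall>r>0. emeasure \<eta> (ball x r) \<le> ennreal (r powr s))}"

text \<open>At the origin the formula gives the value 0; the truncations below never see that point.\<close>

definition riesz_kernel :: "real \<Rightarrow> 'a::euclidean_space \<Rightarrow> 'a" where
  "riesz_kernel s x = x /\<^sub>R (norm x powr (s + 1))"

definition riesz_trunc_op ::
    "'a::euclidean_space measure \<Rightarrow> real \<Rightarrow> real \<Rightarrow> ('a \<Rightarrow> real) \<Rightarrow> 'a \<Rightarrow> 'a" where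
  "riesz_trunc_op \<nu> s \<epsilon> f x =
     (LINT y:{y. norm (y - x) > \<epsilon>}|\<nu>. f y *\<^sub>R riesz_kernel s (y - x))"

definition riesz_trunc ::
    "'a::euclidean_space measure \<Rightarrow> real \<Rightarrow> real \<Rightarrow> 'a \<Rightarrow> 'a" where
  "riesz_trunc \<nu> s \<epsilon> x = (LINT y:{y. norm (y - x) > \<epsilon>}|\<nu>. riesz_kernel s (y - x))"

definition riesz_exists :: "'a::euclidean_space measure \<Rightarrow> real \<Rightarrow> 'a \<Rightarrow> bool" where
  "riesz_exists \<nu> s x \<longleftrightarrow> (\<exists>l. ((\<lambda>\<epsilon>. riesz_trunc \<nu> s \<epsilon> x) \<longlongrightarrow> l) (at_right 0))"

text \<open>Where the limit does not exist, \<open>riesz\<close> takes one fixed unspecified value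
  (that of \<open>THE l. False\<close>).\<close>

definition riesz :: "'a::euclidean_space measure \<Rightarrow> real \<Rightarrow> 'a \<Rightarrow> 'a" where
  "riesz \<nu> s x = Lim (at_right 0) (\<lambda>\<epsilon>. riesz_trunc \<nu> s \<epsilon> x)"

definition riesz_max :: "'a::euclidean_space measure \<Rightarrow> real \<Rightarrow> 'a \<Rightarrow> ennreal" where
  "riesz_max \<nu> s x = (SUP \<epsilon>\<in>{0<..}. ennreal (norm (riesz_trunc \<nu> s \<epsilon> x)))"

definition ennreal_sqrt :: "ennreal \<Rightarrow> ennreal" where
  "ennreal_sqrt t = (if t = \<infinity> then \<infinity> else ennreal (sqrt (enn2real t)))"

text \<open>The norm is taken of \<open>[0, \<infinity>]\<close>-valued functions, so that it applies both to the length of a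
  vector-valued function and to the maximal transform; it is infinite outside \<open>L\<^sup>2\<close>.\<close>

definition L2_norm :: "'a measure \<Rightarrow> ('a \<Rightarrow> ennreal) \<Rightarrow> ennreal" where
  "L2_norm M g = ennreal_sqrt (\<integral>\<^sup>+x. (g x)\<^sup>2 \<partial>M)"

definition L2_op_norm ::
    "'a measure \<Rightarrow> (('a \<Rightarrow> real) \<Rightarrow> 'a \<Rightarrow> 'b::real_normed_vector) \<Rightarrow> ennreal" where
  "L2_op_norm M T =
     (SUP f\<in>{f \<in> borel_measurable M. L2_norm M (\<lambda>x. ennreal \<bar>f x\<bar>) \<le> 1}.
        L2_norm M (\<lambda>x. ennreal (norm (T f x))))"

definition riesz_norm :: "'a::euclidean_space measure \<Rightarrow> real \<Rightarrow> ennreal" where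
  "riesz_norm \<nu> s = (SUP \<epsilon>\<in>{0<..}. L2_op_norm \<nu> (riesz_trunc_op \<nu> s \<epsilon>))"

lemma ennreal_sqrt_power2: "(ennreal_sqrt t)\<^sup>2 = t"
  by (cases t) (auto simp: ennreal_sqrt_def ennreal_power ennreal_top_eq_mult_iff power2_eq_square
      simp flip: ennreal_mult)

lemma L2_norm_power2: "(L2_norm M g)\<^sup>2 = (\<integral>\<^sup>+x. (g x)\<^sup>2 \<partial>M)"
  by (simp add: L2_norm_def ennreal_sqrt_power2)

end

(* The fourth moment of the maximal transform is at most a constant times the total mass. This comes
   from a good-lambda inequality, additive because the transform is applied to the constant 1: the
   level set of height t + A has at most 1/32 of the mass of the level set of height t. By the growth
   condition every scale can be enlarged to a doubling one at bounded cost, and on the cover by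
   doubling balls the L2 bound is needed only for indicator functions, so neither a weak (1,1) bound
   nor interpolation enters. The limit transform is dominated a.e. by the maximal one. If F is either
   squared transform, F <= b + (q/2) F^2 + 1_{F > b} / (2 q), and integrating with q proportional to
   a - b gives (1); (2) is Chebyshev's inequality. *)

theory Submission
  imports Defs
begin

section \<open>Riesz potentials of measures with power growth\<close>

text \<open>To bound the size of a level set of F from below by its mean one must control F^2, the
  fourth power of the transform, while the operator bound only sees squares. The obstacle to gaining
  integrability is that the measure need not be doubling: the error made near a point is controlled
  by the mass of a larger ball, which may far exceed the mass of the ball it is compared with.
  Therefore doubling is tested with the constant 2 * 10^s along radii multiplied by 10. As long as
  it fails, the density mass / r^s more than doubles at each step, so the total cost of enlargement
  is a geometric sum dominated by its last term, and growth bounds that term. The factor 10 leaves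
  room for the Vitali dilation by 5: points of the dilated ball stay at distance 5R from the outside
  of the tenfold ball. The ratio 1/32 is chosen to beat 16 = 2^4, the rate allowed for fourth powers
  of successive levels. Radii are at first kept on a grid 10^k \<delta> with \<delta> > 0, which
  gives a largest bad scale and one fixed truncation to which the L2 bound is applied; no constant
  depends on \<delta>.\<close>

lemma norm_riesz_kernel: "norm (riesz_kernel s v) = norm v powr (- s)"
proof (cases "v = 0")
  case False
  then have "norm v powr (s + 1) = norm v powr s * norm v"
    by (simp add: powr_add)
  with False show ?thesis
    by (simp add: riesz_kernel_def powr_minus divide_simps)
qed (simp add: riesz_kernel_def)

lemma borel_measurable_riesz_kernel [measurable]: "riesz_kernel s \<in> borel_measurable borel"
  unfolding riesz_kernel_def by measurable

text \<open>Mean value theorem on the half-line from \<open>a / 2\<close>, which contains both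
  points and on which the derivative is largest in absolute value at the endpoint.\<close>

lemma powr_neg_diff_le:
  fixes a b p :: real
  assumes "0 < a" "a / 2 \<le> b" "0 \<le> p"
  shows "\<bar>a powr (- p) - b powr (- p)\<bar> \<le> p * (a / 2) powr (- p - 1) * \<bar>a - b\<bar>"
proof -
  have "norm (a powr (- p) - b powr (- p)) \<le> (p * (a / 2) powr (- p - 1)) * norm (a - b)"
  proof (rule field_differentiable_bound[where S = "{a/2..}"])
    fix z assume z: "z \<in> {a/2..}"
    then have "z > 0" using assms(1) by simp
    then show "((\<lambda>x. x powr (- p)) has_field_derivative (- p * z powr (- p - 1))) (at z within {a/2..})"
      by (auto intro!: derivative_eq_intros)
    have "z powr (- p - 1) \<le> (a/2) powr (- p - 1)"
      by (rule powr_mono2') (use z assms in auto)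
    then show "norm (- p * z powr (- p - 1)) \<le> p * (a/2) powr (- p - 1)"
      using assms(3) by (simp add: abs_mult mult_left_mono)
  qed (use assms in auto)
  then show ?thesis by simp
qed

text \<open>Calderon-Zygmund smoothness of the kernel. Written as a scalar power times a vector, the
  difference splits into a moved vector and a changed scalar. Since \<open>norm w\<close> lies
  between 1/2 and 3/2 of \<open>norm v\<close>, the scalar part costs (3/2) (s+1) 2^(s+2) = 3 (s+1)
  2^(s+1).\<close>

lemma riesz_kernel_diff_le:
  fixes v w :: "'a::euclidean_space"
  assumes s: "0 < s" and vw: "2 * norm (v - w) \<le> norm v"
  shows "norm (riesz_kernel s v - riesz_kernel s w)
           \<le> (1 + 3 * (s + 1) * 2 powr (s + 1)) * norm (v - w) * norm v powr (- (s + 1))"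
proof (cases "v = 0")
  case False
  define p where "p = s + 1"
  have p: "p > 1" "0 \<le> p" using s by (auto simp: p_def)
  define D where "D = norm (v - w)"
  have v: "norm v > 0" using False by simp
  have w: "norm v / 2 \<le> norm w" "norm w \<le> (3/2) * norm v"
    using vw norm_triangle_ineq2[of v w] norm_triangle_ineq2[of w v] by (auto simp: norm_minus_commute)
  have K: "riesz_kernel s u = (norm u powr (- p)) *\<^sub>R u" for u :: 'a
    by (simp add: riesz_kernel_def p_def flip: powr_minus)
  have "riesz_kernel s v - riesz_kernel s w
      = (norm v powr (- p)) *\<^sub>R (v - w) + (norm v powr (- p) - norm w powr (- p)) *\<^sub>R w"
    by (simp add: K algebra_simps)
  then have "norm (riesz_kernel s v - riesz_kernel s w)
      \<le> norm v powr (- p) * D + \<bar>norm v powr (- p) - norm w powr (- p)\<bar> * norm w"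
    by (metis D_def norm_triangle_ineq norm_scaleR abs_of_nonneg powr_ge_zero)
  also have "\<bar>norm v powr (- p) - norm w powr (- p)\<bar> * norm w
      \<le> (p * (norm v / 2) powr (- p - 1) * D) * ((3/2) * norm v)"
  proof (intro mult_mono)
    have "\<bar>norm v powr (- p) - norm w powr (- p)\<bar> \<le> p * (norm v / 2) powr (- p - 1) * \<bar>norm v - norm w\<bar>"
      by (rule powr_neg_diff_le) (use v w p in auto)
    also have "\<dots> \<le> p * (norm v / 2) powr (- p - 1) * D"
      using p by (intro mult_left_mono) (auto simp: D_def norm_triangle_ineq3)
    finally show "\<bar>norm v powr (- p) - norm w powr (- p)\<bar> \<le> p * (norm v / 2) powr (- p - 1) * D" .
  qed (use w p in \<open>auto simp: D_def\<close>)
  also have "(norm v / 2) powr (- p - 1) = norm v powr (- p) * 2 powr (p + 1) / norm v"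
    using v by (simp add: powr_divide powr_diff powr_minus powr_add divide_simps)
  also have "(p * (norm v powr (- p) * 2 powr (p + 1) / norm v) * D) * ((3/2) * norm v)
      = 3 * p * 2 powr p * D * norm v powr (- p)"
    using v by (simp add: powr_add)
  finally show ?thesis by (simp add: D_def p_def algebra_simps)
qed (use vw in \<open>simp add: riesz_kernel_def\<close>)

lemma suminf_ge_term:
  fixes f :: "nat \<Rightarrow> ennreal"
  shows "f n \<le> (\<Sum>i. f i)"
  using sum_le_suminf[of f "{n}"] by simp

text \<open>Truncations and all near and far pieces are integrals of one kernel over different sets
  with a movable centre, so that passing between them is set algebra.\<close>

definition riesz_pot :: "'a::euclidean_space measure \<Rightarrow> real \<Rightarrow> 'a set \<Rightarrow> 'a \<Rightarrow> 'a" where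
  "riesz_pot M s S x = (LINT y:S|M. riesz_kernel s (y - x))"

lemma riesz_trunc_eq_pot: "riesz_trunc M s \<epsilon> x = riesz_pot M s (- cball x \<epsilon>) x"
proof -
  have "{y. norm (y - x) > \<epsilon>} = - cball x \<epsilon>"
    by (auto simp: dist_norm norm_minus_commute)
  then show ?thesis by (simp add: riesz_trunc_def riesz_pot_def)
qed

lemma riesz_trunc_op_indicator:
  "riesz_trunc_op M s \<epsilon> (\<lambda>y. a * indicator E y) x = a *\<^sub>R riesz_pot M s (E - cball x \<epsilon>) x"
proof -
  have "riesz_trunc_op M s \<epsilon> (\<lambda>y. a * indicator E y) x
      = (LINT y|M. a *\<^sub>R (indicator (E - cball x \<epsilon>) y *\<^sub>R riesz_kernel s (y - x)))"
    unfolding riesz_trunc_op_def set_lebesgue_integral_def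
    by (intro Bochner_Integration.integral_cong)
       (auto simp: indicator_def dist_norm norm_minus_commute)
  then show ?thesis
    by (simp only: riesz_pot_def set_lebesgue_integral_def integral_scaleR_right)
qed

locale growth_measure = finite_measure M for M :: "'a::euclidean_space measure" +
  fixes s :: real
  assumes s_pos: "0 < s"
    and sets_M [measurable_cong]: "sets M = sets borel"
    and growth: "0 < r \<Longrightarrow> measure M (ball x r) \<le> r powr s"
begin

lemma space_M [simp]: "space M = UNIV"
  using sets_eq_imp_space_eq[OF sets_M] by simp

text \<open>Truncations remove closed balls whereas growth speaks of open ones; the factor 2 pays
  for the passage.\<close>

lemma measure_cball_le:
  assumes "0 < r" shows "measure M (cball x r) \<le> (2 * r) powr s"
proof -
  have "measure M (cball x r) \<le> measure M (ball x (2 * r))"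
    by (rule finite_measure_mono) (use assms in \<open>auto simp: sets_M\<close>)
  also have "\<dots> \<le> (2 * r) powr s" by (rule growth) (use assms in auto)
  finally show ?thesis .
qed

lemma kernel_integrable:
  assumes S: "S \<in> sets borel" and r: "0 < r" and far: "\<And>y. y \<in> S \<Longrightarrow> r \<le> dist x y"
  shows "set_integrable M S (\<lambda>y. riesz_kernel s (y - x))"
  unfolding set_integrable_def
proof (rule integrable_const_bound)
  show "AE y in M. norm (indicator S y *\<^sub>R riesz_kernel s (y - x)) \<le> r powr (- s)"
    by (intro always_eventually allI)
       (use r s_pos far in \<open>auto simp: norm_riesz_kernel indicator_def dist_norm norm_minus_commute intro!: powr_mono2'\<close>)
  show "(\<lambda>y. indicator S y *\<^sub>R riesz_kernel s (y - x)) \<in> borel_measurable M"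
    using S by measurable
qed

lemma norm_riesz_pot_le:
  assumes S: "S \<in> sets borel" and r: "0 < r" and far: "\<And>y. y \<in> S \<Longrightarrow> r \<le> dist x y"
  shows "norm (riesz_pot M s S x) \<le> measure M S * r powr (- s)"
proof -
  have "norm (riesz_pot M s S x) \<le> (LINT y|M. norm (indicator S y *\<^sub>R riesz_kernel s (y - x)))"
    unfolding riesz_pot_def set_lebesgue_integral_def by (rule integral_norm_bound)
  also have "\<dots> \<le> (LINT y|M. indicator S y *\<^sub>R r powr (- s))"
  proof (rule integral_mono)
    show "integrable M (\<lambda>y. norm (indicator S y *\<^sub>R riesz_kernel s (y - x)))"
      using kernel_integrable[OF assms] unfolding set_integrable_def by (rule integrable_norm)
    show "integrable M (\<lambda>y. indicator S y *\<^sub>R r powr (- s))"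
      using S by (intro integrable_scaleR_left integrable_indicator) (auto simp: sets_M less_top[symmetric])
  qed (use r s_pos far in \<open>auto simp: norm_riesz_kernel indicator_def dist_norm norm_minus_commute intro!: powr_mono2'\<close>)
  also have "\<dots> = measure M S * r powr (- s)"
    by simp
  finally show ?thesis .
qed

lemma riesz_pot_Un:
  assumes "S \<in> sets borel" "T \<in> sets borel" "S \<inter> T = {}" "0 < r"
    and "\<And>y. y \<in> S \<union> T \<Longrightarrow> r \<le> dist x y"
  shows "riesz_pot M s (S \<union> T) x = riesz_pot M s S x + riesz_pot M s T x"
  unfolding riesz_pot_def
  by (rule set_integral_Un) (use assms in \<open>auto intro!: kernel_integrable[of _ r]\<close>)

lemma riesz_pot_Diff:
  assumes "S \<in> sets borel" "T \<in> sets borel" "T \<subseteq> S" "0 < r"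
    and "\<And>y. y \<in> S \<Longrightarrow> r \<le> dist x y"
  shows "riesz_pot M s S x - riesz_pot M s T x = riesz_pot M s (S - T) x"
proof -
  have "T \<union> (S - T) = S" using assms by auto
  then show ?thesis
    using riesz_pot_Un[of T "S - T" r x] assms by auto
qed

text \<open>The domain of integration moves with \<open>x\<close>. Its indicator, read as a function
  of the pair, is Borel on the product, so measurability of parameter integrals applies.\<close>

lemma measurable_riesz_pot [measurable]:
  assumes [measurable]: "E \<in> sets borel"
  shows "(\<lambda>x. riesz_pot M s (E - cball x \<epsilon>) x) \<in> borel_measurable borel"
proof -
  have *: "riesz_pot M s (E - cball x \<epsilon>) x
      = (LINT y|M. indicator {z. \<epsilon> < dist (fst z) (snd z) \<and> snd z \<in> E} (x, y) *\<^sub>R riesz_kernel s (y - x))" for x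
    unfolding riesz_pot_def set_lebesgue_integral_def
    by (intro Bochner_Integration.integral_cong) (auto simp: indicator_def)
  have [measurable]: "{z :: 'a \<times> 'a. \<epsilon> < dist (fst z) (snd z) \<and> snd z \<in> E} \<in> sets (borel \<Otimes>\<^sub>M borel)"
  proof -
    have "Measurable.pred (borel \<Otimes>\<^sub>M borel) (\<lambda>z :: 'a \<times> 'a. \<epsilon> < dist (fst z) (snd z) \<and> snd z \<in> E)"
      by measurable
    then show ?thesis by (simp add: pred_def space_pair_measure)
  qed
  have "(\<lambda>(x, y). indicator {z. \<epsilon> < dist (fst z) (snd z) \<and> snd z \<in> E} (x, y) *\<^sub>R riesz_kernel s (y - x))
      \<in> borel_measurable (borel \<Otimes>\<^sub>M borel)"
    by measurable
  then have "(\<lambda>(x, y). indicator {z. \<epsilon> < dist (fst z) (snd z) \<and> snd z \<in> E} (x, y) *\<^sub>R riesz_kernel s (y - x))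
      \<in> borel_measurable (borel \<Otimes>\<^sub>M M)"
    by (simp add: measurable_cong_sets[OF sets_pair_measure_cong[OF refl sets_M] refl])
  from borel_measurable_lebesgue_integral[OF this] show ?thesis
    by (simp add: *)
qed

end

text \<open>Smoothness constant of the kernel times a tail sum: a displacement of at most r/2 meets
  the tail bound 2 * 4^s / r, and the radius cancels.\<close>

definition osc_const :: "real \<Rightarrow> real" where
  "osc_const s = (1 + 3 * (s + 1) * 2 powr (s + 1)) * 4 powr s"

text \<open>\<open>3 * 20 powr s\<close> is the cost of enlarging a truncation to a doubling scale,
  \<open>osc_const s\<close> that of moving the centre of the far potential.\<close>

definition cotlar_const :: "real \<Rightarrow> real" where
  "cotlar_const s = 3 * 20 powr s + osc_const s"

text \<open>Here the removed ball moves along with the centre, which adds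
  \<open>2 * 4 powr s\<close> for the two parts of a symmetric difference of balls.\<close>

definition step_const :: "real \<Rightarrow> real" where
  "step_const s = 3 * 20 powr s + osc_const s + 2 * 4 powr s"

text \<open>Height of one good-lambda step. Two \<open>step_const\<close> absorb the far potential;
  the rest is the height left for the local potential, where \<open>32 * 10 powr s\<close> makes the
  weak Cotlar factor times the doubling constant equal to 1/64.\<close>

definition jump_const :: "real \<Rightarrow> real" where
  "jump_const s = 2 * step_const s + cotlar_const s + 32 * 10 powr s"

lemma osc_const_nonneg: "0 < s \<Longrightarrow> 0 \<le> osc_const s"
  by (simp add: osc_const_def)

lemma step_const_pos: "0 < s \<Longrightarrow> 0 < step_const s"
proof -
  assume "0 < s"
  have "0 < 20 powr s" "0 < 4 powr s" by simp_all
  with osc_const_nonneg[OF \<open>0 < s\<close>] show ?thesis unfolding step_const_def by linarith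
qed

lemma jump_const_pos: "0 < s \<Longrightarrow> 0 < jump_const s"
proof -
  assume "0 < s"
  have "0 < 20 powr s" "0 < 10 powr s" by simp_all
  with osc_const_nonneg[OF \<open>0 < s\<close>] step_const_pos[OF \<open>0 < s\<close>] show ?thesis
    unfolding jump_const_def cotlar_const_def by linarith
qed

section \<open>Tails, oscillation and change of scale of truncated potentials\<close>

context growth_measure
begin

text \<open>On the shell between 2^i r and 2^(i+1) r the integrand is at most (2^i r)^(-s-1) and the
  mass at most (4 * 2^i r)^s. The exponent exceeds the growth exponent by 1, so the shells form a
  geometric series.\<close>

lemma kernel_tail_le:
  assumes S: "S \<in> sets borel" and r: "0 < r" and far: "\<And>y. y \<in> S \<Longrightarrow> r < dist x y"
  shows "(\<integral>\<^sup>+y. indicator S y * ennreal (dist x y powr (- (s + 1))) \<partial>M) \<le> ennreal (2 * 4 powr s / r)"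
proof -
  define p where "p = s + 1"
  have p: "0 < p" using s_pos by (simp add: p_def)
  let ?f = "\<lambda>i y. ennreal ((2 ^ i * r) powr (- p)) * indicator (cball x (2 ^ Suc i * r)) y"
  have "(\<integral>\<^sup>+y. indicator S y * ennreal (dist x y powr (- p)) \<partial>M) \<le> (\<integral>\<^sup>+y. (\<Sum>i. ?f i y) \<partial>M)"
  proof (rule nn_integral_mono)
    fix y
    show "indicator S y * ennreal (dist x y powr (- p)) \<le> (\<Sum>i. ?f i y)"
    proof (cases "y \<in> S")
      case True
      obtain n where "dist x y / r < 2 ^ n"
        using real_arch_pow[of 2] by auto
      then have ex: "dist x y \<le> 2 ^ n * r" using r by (simp add: field_simps)
      \<comment> \<open>Index of the smallest dyadic ball containing \<open>y\<close>. Strictness in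
        \<open>far\<close> excludes index 0, so there is a preceding ball, and it misses
        \<open>y\<close>.\<close>
      define m where "m = (LEAST n. dist x y \<le> 2 ^ n * r)"
      have m: "dist x y \<le> 2 ^ m * r" unfolding m_def by (rule LeastI, rule ex)
      have "m \<noteq> 0" using m far[OF True] by (cases m) auto
      then obtain i where i: "m = Suc i" by (cases m) auto
      have "\<not> dist x y \<le> 2 ^ i * r"
        using not_less_Least[of i "\<lambda>n. dist x y \<le> 2 ^ n * r"] i by (simp add: m_def)
      then have "dist x y powr (- p) \<le> (2 ^ i * r) powr (- p)"
        by (intro powr_mono2') (use r p in auto)
      then have "indicator S y * ennreal (dist x y powr (- p)) \<le> ?f i y"
        using m i True by (simp add: ennreal_leI)
      also have "\<dots> \<le> (\<Sum>i. ?f i y)"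
        by (rule suminf_ge_term)
      finally show ?thesis .
    qed simp
  qed
  also have "\<dots> = (\<Sum>i. \<integral>\<^sup>+y. ?f i y \<partial>M)"
    by (intro nn_integral_suminf borel_measurable_times_ennreal borel_measurable_const
        borel_measurable_indicator) (simp add: sets_M)
  also have "\<dots> \<le> (\<Sum>i. ennreal (4 powr s / r * (1 / 2) ^ i))"
  proof (rule suminf_le)
    fix i
    have "(\<integral>\<^sup>+y. ?f i y \<partial>M) = ennreal ((2 ^ i * r) powr (- p)) * emeasure M (cball x (2 ^ Suc i * r))"
      by (subst nn_integral_cmult_indicator) (auto simp: sets_M)
    also have "\<dots> = ennreal ((2 ^ i * r) powr (- p) * measure M (cball x (2 ^ Suc i * r)))"
      by (simp add: emeasure_eq_measure ennreal_mult)
    also have "\<dots> \<le> ennreal ((2 ^ i * r) powr (- p) * (2 * (2 ^ Suc i * r)) powr s)"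
      using r by (intro ennreal_leI mult_left_mono measure_cball_le) auto
    also have "(2 ^ i * r) powr (- p) * (2 * (2 ^ Suc i * r)) powr s = 4 powr s / r * (1 / 2) ^ i"
    proof -
      define q where "q = 2 ^ i * r"
      have q: "0 < q" using r by (simp add: q_def)
      have "q powr (- p) * (4 * q) powr s = 4 powr s / q"
        using q by (simp add: powr_mult p_def powr_diff powr_minus)
      then show ?thesis using r by (simp add: q_def power_one_over)
    qed
    finally show "(\<integral>\<^sup>+y. ?f i y \<partial>M) \<le> ennreal (4 powr s / r * (1 / 2) ^ i)" .
  qed auto
  also have "\<dots> = ennreal (2 * 4 powr s / r)"
  proof (rule suminf_ennreal_eq)
    show "(\<lambda>i. 4 powr s / r * (1 / 2) ^ i) sums (2 * 4 powr s / r)"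
      using sums_mult[OF geometric_sums[of "1/2::real"], of "4 powr s / r"] by (simp add: mult.commute)
  qed (use r in auto)
  finally show ?thesis by (simp add: p_def)
qed

text \<open>The kernel difference is at most a constant times r/2 times the power -(s+1) of the
  distance, whose tail is of order 1/r. The bound is therefore free of scale, and the set may be any
  set far from \<open>x\<close>.\<close>

lemma riesz_pot_osc:
  assumes S: "S \<in> sets borel" and r: "0 < r" and far: "\<And>y. y \<in> S \<Longrightarrow> r < dist x y"
    and near: "2 * dist x x' \<le> r"
  shows "norm (riesz_pot M s S x - riesz_pot M s S x') \<le> osc_const s"
proof -
  define k where "k = 1 + 3 * (s + 1) * 2 powr (s + 1)"
  have k: "k \<ge> 0" using s_pos by (simp add: k_def)
  have far': "r / 2 \<le> dist x' y" if "y \<in> S" for y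
    using far[OF that] near dist_triangle[of x y x'] by (simp add: dist_commute)
  have i: "set_integrable M S (\<lambda>y. riesz_kernel s (y - x))"
    "set_integrable M S (\<lambda>y. riesz_kernel s (y - x'))"
    by (rule kernel_integrable[OF S r less_imp_le[OF far]], assumption)
       (rule kernel_integrable[OF S _ far'], use r in auto)
  let ?d = "\<lambda>y. riesz_kernel s (y - x) - riesz_kernel s (y - x')"
  have "ennreal (norm (riesz_pot M s S x - riesz_pot M s S x')) = ennreal (norm (LINT y:S|M. ?d y))"
    using i by (simp add: riesz_pot_def)
  also have "\<dots> \<le> (\<integral>\<^sup>+y. norm (indicator S y *\<^sub>R ?d y) \<partial>M)"
    using set_integral_diff(1)[OF i] unfolding set_lebesgue_integral_def set_integrable_def
    by (rule integral_norm_bound_ennreal)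
  also have "\<dots> \<le> (\<integral>\<^sup>+y. ennreal (k * (r / 2)) * (indicator S y * ennreal (dist x y powr (- (s + 1)))) \<partial>M)"
  proof (rule nn_integral_mono)
    fix y
    show "ennreal (norm (indicator S y *\<^sub>R ?d y))
        \<le> ennreal (k * (r / 2)) * (indicator S y * ennreal (dist x y powr (- (s + 1))))"
    proof (cases "y \<in> S")
      case True
      have "norm (?d y) \<le> k * norm ((y - x) - (y - x')) * norm (y - x) powr (- (s + 1))"
        unfolding k_def
        by (rule riesz_kernel_diff_le[OF s_pos])
           (use far[OF True] near in \<open>auto simp: dist_norm norm_minus_commute\<close>)
      also have "\<dots> \<le> k * (r / 2) * norm (y - x) powr (- (s + 1))"
        using near k by (intro mult_right_mono mult_left_mono) (auto simp: dist_norm norm_minus_commute)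
      finally show ?thesis
        using True r k by (simp add: dist_norm norm_minus_commute ennreal_mult[symmetric] ennreal_leI)
    qed simp
  qed
  also have "\<dots> = ennreal (k * (r / 2)) * (\<integral>\<^sup>+y. indicator S y * ennreal (dist x y powr (- (s + 1))) \<partial>M)"
  proof (rule nn_integral_cmult)
    note S [measurable]
    show "(\<lambda>y. indicator S y * ennreal (dist x y powr (- (s + 1)))) \<in> borel_measurable M"
      by measurable
  qed
  also have "\<dots> \<le> ennreal (k * (r / 2)) * ennreal (2 * 4 powr s / r)"
    by (intro mult_left_mono kernel_tail_le assms) auto
  also have "\<dots> = ennreal (osc_const s)"
    using r k unfolding osc_const_def k_def[symmetric] by (simp flip: ennreal_mult)
  finally show ?thesis
    using s_pos by (simp add: osc_const_def)
qed

lemma riesz_pot_scale: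
  assumes E: "E \<in> sets borel" and r: "0 < r" "r \<le> r'"
  shows "norm (riesz_pot M s (E - cball x r) x - riesz_pot M s (E - cball x r') x)
     \<le> measure M (cball x r') * r powr (- s)"
proof -
  have "riesz_pot M s (E - cball x r) x - riesz_pot M s (E - cball x r') x
      = riesz_pot M s ((E - cball x r) - (E - cball x r')) x"
    by (rule riesz_pot_Diff[of _ _ r]) (use assms in auto)
  also have "norm \<dots> \<le> measure M ((E - cball x r) - (E - cball x r')) * r powr (- s)"
    by (rule norm_riesz_pot_le) (use assms in auto)
  also have "\<dots> \<le> measure M (cball x r') * r powr (- s)"
    by (intro mult_right_mono finite_measure_mono) (auto simp: sets_M)
  finally show ?thesis .
qed

text \<open>Moving the base point over a fixed set costs \<open>osc_const\<close>. Each half of the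
  symmetric difference of the two exteriors lies in a ball of radius r and at distance at least r/2
  from \<open>x'\<close>, hence contributes at most (2r)^s (r/2)^(-s) = 4^s.\<close>

lemma riesz_trunc_osc:
  assumes E: "E \<in> sets borel" and r: "0 < r" and near: "2 * dist x x' \<le> r"
  shows "norm (riesz_pot M s (E - cball x r) x - riesz_pot M s (E - cball x' r) x')
      \<le> osc_const s + 2 * 4 powr s"
proof -
  define P Q where "P = E - cball x r" and "Q = E - cball x' r"
  have [measurable]: "P \<in> sets borel" "Q \<in> sets borel" using E by (auto simp: P_def Q_def)
  have far: "r / 2 \<le> dist x' y" if "y \<in> P \<union> Q" for y
    using that r near dist_triangle[of x y x'] by (auto simp: P_def Q_def dist_commute)
  have small: "norm (riesz_pot M s T x') \<le> 4 powr s"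
    if "T \<in> sets borel" "T \<subseteq> P \<union> Q" "T \<subseteq> cball z r" for T z
  proof -
    have "norm (riesz_pot M s T x') \<le> measure M T * (r/2) powr (- s)"
      by (rule norm_riesz_pot_le) (use r far that in auto)
    also have "\<dots> \<le> (2 * r) powr s * (r/2) powr (- s)"
    proof (intro mult_right_mono)
      have "measure M T \<le> measure M (cball z r)"
        using that by (intro finite_measure_mono) (auto simp: sets_M)
      also have "\<dots> \<le> (2 * r) powr s" using r by (rule measure_cball_le)
      finally show "measure M T \<le> (2 * r) powr s" .
    qed auto
    also have "\<dots> = 4 powr s"
    proof -
      have "2 * r = 4 * (r / 2)" by simp
      then have "(2 * r) powr s = 4 powr s * (r / 2) powr s" using r by (metis powr_mult)
      then show ?thesis using r by (simp add: powr_minus)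
    qed
    finally show ?thesis .
  qed
  have "riesz_pot M s P x' - riesz_pot M s (P \<inter> Q) x' = riesz_pot M s (P - Q) x'"
    using riesz_pot_Diff[of P "P \<inter> Q" "r/2" x'] far r by (auto simp: Diff_Int)
  moreover have "riesz_pot M s Q x' - riesz_pot M s (P \<inter> Q) x' = riesz_pot M s (Q - P) x'"
    using riesz_pot_Diff[of Q "P \<inter> Q" "r/2" x'] far r by (auto simp: Diff_Int)
  ultimately have "riesz_pot M s P x - riesz_pot M s Q x' = (riesz_pot M s P x - riesz_pot M s P x')
      + (riesz_pot M s (P - Q) x' - riesz_pot M s (Q - P) x')"
    by (simp add: algebra_simps)
  moreover have "norm (riesz_pot M s P x - riesz_pot M s P x') \<le> osc_const s"
    by (rule riesz_pot_osc[of _ r]) (use r near in \<open>auto simp: P_def E\<close>)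
  moreover have "norm (riesz_pot M s (P - Q) x') \<le> 4 powr s"
    by (rule small[of _ x']) (auto simp: P_def Q_def intro!: sets.Diff E)
  moreover have "norm (riesz_pot M s (Q - P) x') \<le> 4 powr s"
    by (rule small[of _ x]) (auto simp: P_def Q_def intro!: sets.Diff E)
  ultimately show ?thesis
    unfolding P_def[symmetric] Q_def[symmetric]
    by (smt (verit) norm_triangle_ineq norm_triangle_ineq4)
qed

text \<open>The form of the bound reproduces itself: failure of doubling turns the bound at radius R
  into at most m(10R) R^(-s), which is also the cost of the next annulus, and twice this is the
  bound at radius 10R.\<close>

lemma riesz_trunc_nondoubling:
  assumes E: "E \<in> sets borel" and r: "0 < r"
    and nd: "\<And>i. i < j \<Longrightarrow> 2 * 10 powr s * measure M (cball x (10 ^ i * r)) < measure M (cball x (10 ^ Suc i * r))"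
  shows "norm (riesz_pot M s (E - cball x r) x - riesz_pot M s (E - cball x (10 ^ j * r)) x)
     \<le> 2 * 10 powr s * measure M (cball x (10 ^ j * r)) * (10 ^ j * r) powr (- s)"
  using nd
proof (induction j)
  case (Suc j)
  define R where "R = 10 ^ j * r"
  have R: "R > 0" using r by (simp add: R_def)
  have SR: "10 ^ Suc j * r = 10 * R" by (simp add: R_def)
  have eq: "10 powr s * (10 * R) powr (- s) = R powr (- s)"
    using R by (simp add: powr_mult powr_minus)
  have "norm (riesz_pot M s (E - cball x r) x - riesz_pot M s (E - cball x (10 * R)) x)
     \<le> 2 * 10 powr s * measure M (cball x R) * R powr (- s) + measure M (cball x (10 * R)) * R powr (- s)"
    using Suc riesz_pot_scale[OF E R, of "10 * R" x] R norm_diff_triangle_le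
    unfolding R_def by (smt (verit) less_SucI)
  also have "\<dots> \<le> measure M (cball x (10 * R)) * R powr (- s) + measure M (cball x (10 * R)) * R powr (- s)"
    using Suc.prems[of j] R unfolding SR R_def[symmetric] by (intro add_mono mult_right_mono) auto
  also have "\<dots> = 2 * 10 powr s * measure M (cball x (10 * R)) * (10 * R) powr (- s)"
    using eq[symmetric] by simp
  finally show ?case by (simp only: SR)
qed (use assms in simp)

text \<open>Doubling cannot fail at every scale, since the masses would then double forever inside a
  finite measure. Up to the least doubling scale R the cost is at most 2 * 20^s by growth; the last
  step to 10R adds 20^s.\<close>

lemma riesz_trunc_doubling:
  assumes E: "E \<in> sets borel" and r: "0 < r"
  obtains j where "measure M (cball x (10 ^ Suc j * r)) \<le> 2 * 10 powr s * measure M (cball x (10 ^ j * r))"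
    and "norm (riesz_pot M s (E - cball x r) x - riesz_pot M s (E - cball x (10 ^ Suc j * r)) x)
           \<le> 3 * 20 powr s"
proof -
  define D where "D = 2 * 10 powr s"
  define m where "m = (\<lambda>j. measure M (cball x (10 ^ j * r)))"
  have D: "D \<ge> 2" using s_pos by (simp add: D_def ge_one_powr_ge_zero)
  have "\<exists>j. m (Suc j) \<le> D * m j"
  proof (rule ccontr)
    assume "\<not> ?thesis"
    then have grow: "D * m j < m (Suc j)" for j by (auto simp: not_le)
    have "m 0 \<ge> 0" by (simp add: m_def)
    \<comment> \<open>\<open>m 0\<close> may vanish, so the exponential growth is started from
      \<open>m 1\<close>, which is positive because doubling fails at 0.\<close>
    then have pos: "0 < m 1" using grow[of 0] D by (smt (verit) One_nat_def mult_nonneg_nonneg)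
    have "2 ^ j * m 1 \<le> m (Suc j)" for j
    proof (induction j)
      case (Suc j)
      have "2 ^ Suc j * m 1 \<le> 2 * m (Suc j)" using Suc by simp
      also have "\<dots> \<le> D * m (Suc j)" using D by (intro mult_right_mono) (auto simp: m_def)
      finally show ?case using grow[of "Suc j"] by simp
    qed simp
    moreover have "m (Suc j) \<le> measure M UNIV" for j
      unfolding m_def by (rule finite_measure_mono) (auto simp: sets_M)
    ultimately have "2 ^ j * m 1 \<le> measure M UNIV" for j by (meson order_trans)
    moreover obtain n where "measure M UNIV / m 1 < 2 ^ n" using real_arch_pow[of 2] by auto
    ultimately show False using pos by (metis divide_less_eq not_le)
  qed
  define j where "j = (LEAST j. m (Suc j) \<le> D * m j)"
  have j: "m (Suc j) \<le> D * m j" unfolding j_def by (rule LeastI_ex) fact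
  have nd: "D * m i < m (Suc i)" if "i < j" for i
    using not_less_Least[of i "\<lambda>j. m (Suc j) \<le> D * m j"] that by (auto simp: j_def)
  define R where "R = 10 ^ j * r"
  have R: "0 < R" using r by (simp add: R_def)
  have SR: "10 ^ Suc j * r = 10 * R" by (simp add: R_def)
  have pw: "(a * R) powr s * R powr (- s) = a powr s" if "a > 0" for a :: real
    using that R by (simp add: powr_mult powr_minus)
  have "norm (riesz_pot M s (E - cball x r) x - riesz_pot M s (E - cball x R) x)
      \<le> 2 * 10 powr s * measure M (cball x R) * R powr (- s)"
    unfolding R_def by (rule riesz_trunc_nondoubling[OF E r]) (use nd in \<open>auto simp: D_def m_def\<close>)
  also have "\<dots> \<le> 2 * 10 powr s * (2 * R) powr s * R powr (- s)"
    using R by (intro mult_right_mono mult_left_mono measure_cball_le) auto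
  also have "\<dots> = 2 * 20 powr s"
    using pw[of 2] powr_mult[of 10 2 s] by (simp add: mult.assoc)
  finally have 1: "norm (riesz_pot M s (E - cball x r) x - riesz_pot M s (E - cball x R) x) \<le> 2 * 20 powr s" .
  have "norm (riesz_pot M s (E - cball x R) x - riesz_pot M s (E - cball x (10 * R)) x)
      \<le> measure M (cball x (10 * R)) * R powr (- s)"
    by (rule riesz_pot_scale) (use E R in auto)
  also have "\<dots> \<le> (2 * (10 * R)) powr s * R powr (- s)"
    using R by (intro mult_right_mono measure_cball_le) auto
  also have "\<dots> = 20 powr s"
  proof -
    have "2 * (10 * R) = 20 * R" by simp
    then show ?thesis using pw[of 20] by (simp only:)
  qed
  finally have 2: "norm (riesz_pot M s (E - cball x R) x - riesz_pot M s (E - cball x (10 * R)) x) \<le> 20 powr s" .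
  show ?thesis
  proof (rule that[of j])
    show "measure M (cball x (10 ^ Suc j * r)) \<le> 2 * 10 powr s * measure M (cball x (10 ^ j * r))"
      using j by (simp add: m_def D_def)
    show "norm (riesz_pot M s (E - cball x r) x - riesz_pot M s (E - cball x (10 ^ Suc j * r)) x) \<le> 3 * 20 powr s"
      using norm_diff_triangle_le[OF 1 2] unfolding SR by simp
  qed
qed

end

section \<open>The good-lambda inequality\<close>

lemma emeasure_UN_le_count_space:
  assumes A: "countable I" "\<And>i. i \<in> I \<Longrightarrow> X i \<in> sets M"
  shows "emeasure M (\<Union>i\<in>I. X i) \<le> (\<integral>\<^sup>+i. emeasure M (X i) \<partial>count_space I)"
proof -
  have "emeasure M (\<Union>i\<in>I. X i) = (\<integral>\<^sup>+x. indicator (\<Union>i\<in>I. X i) x \<partial>M)"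
    using A by (subst nn_integral_indicator) auto
  also have "\<dots> \<le> (\<integral>\<^sup>+x. \<integral>\<^sup>+i. indicator (X i) x \<partial>count_space I \<partial>M)"
  proof (rule nn_integral_mono)
    fix x
    show "(indicator (\<Union>i\<in>I. X i) x :: ennreal) \<le> (\<integral>\<^sup>+i. indicator (X i) x \<partial>count_space I)"
    proof (cases "x \<in> (\<Union>i\<in>I. X i)")
      case True
      then obtain j where "j \<in> I" "x \<in> X j" by auto
      then show ?thesis
        using nn_integral_ge_point[of j I "\<lambda>i. indicator (X i) x"] by (auto simp: indicator_def)
    qed simp
  qed
  also have "\<dots> = (\<integral>\<^sup>+i. \<integral>\<^sup>+x. indicator (X i) x \<partial>M \<partial>count_space I)"
    using A by (intro nn_integral_count_space_nn_integral) auto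
  also have "\<dots> = (\<integral>\<^sup>+i. emeasure M (X i) \<partial>count_space I)"
    using A by (intro nn_integral_cong) simp
  finally show ?thesis .
qed

text \<open>The comparison measure \<open>N\<close> is meant to be either \<open>M\<close> restricted to a set containing
  all the balls, or \<open>M\<close> with the squared truncated transform as density.\<close>

lemma emeasure_le_by_Vitali:
  fixes M N :: "'a::euclidean_space measure"
  assumes [measurable_cong]: "sets M = sets borel" "sets N = sets borel"
    and S [measurable]: "S \<in> sets borel"
    and R: "\<And>x. x \<in> S \<Longrightarrow> 0 < R x \<and> R x \<le> B"
    and le: "\<And>x. x \<in> S \<Longrightarrow> emeasure M (S \<inter> cball x (5 * R x)) \<le> \<kappa> * emeasure N (cball x (R x))"
  shows "emeasure M S \<le> \<kappa> * emeasure N UNIV"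
proof -
  have "S \<subseteq> (\<Union>x\<in>S. cball x (R x))" using R by fastforce
  \<comment> \<open>The balls of the subfamily are disjoint and their fivefold dilates cover
    \<open>S\<close>, which is why the hypothesis compares radius 5R with radius R. Sums over
    \<open>C\<close> are integrals against counting measure, so no enumeration of \<open>C\<close>
    is needed.\<close>
  then obtain C where C: "countable C" "C \<subseteq> S"
    "pairwise (\<lambda>i j. disjnt (cball i (R i)) (cball j (R j))) C"
    "S \<subseteq> (\<Union>i\<in>C. cball i (5 * R i))"
    by (rule Vitali_covering_lemma_cballs[of S "\<lambda>x. x" R S B, OF _ R])
  have "emeasure M S = emeasure M (\<Union>x\<in>C. S \<inter> cball x (5 * R x))"
    using C(4) by (intro arg_cong[where f = "emeasure M"]) auto
  also have "\<dots> \<le> (\<integral>\<^sup>+x. emeasure M (S \<inter> cball x (5 * R x)) \<partial>count_space C)"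
    by (rule emeasure_UN_le_count_space[OF C(1)]) measurable
  also have "\<dots> \<le> (\<integral>\<^sup>+x. \<kappa> * emeasure N (cball x (R x)) \<partial>count_space C)"
    using C(2) le by (intro nn_integral_mono) auto
  also have "\<dots> = \<kappa> * (\<integral>\<^sup>+x. emeasure N (cball x (R x)) \<partial>count_space C)"
    by (rule nn_integral_cmult) simp
  also have "(\<integral>\<^sup>+x. emeasure N (cball x (R x)) \<partial>count_space C) = emeasure N (\<Union>x\<in>C. cball x (R x))"
    using C by (intro emeasure_UN_countable[symmetric])
      (auto simp: disjoint_family_on_def pairwise_def disjnt_def assms(2))
  also have "\<dots> \<le> emeasure N UNIV"
    by (intro emeasure_mono) (auto simp: assms(2))
  finally show ?thesis by (simp add: mult_left_mono)
qed

section \<open>Level sets of truncations on a geometric grid of radii\<close>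

locale bounded_riesz = growth_measure +
  assumes L2_bound: "0 < \<epsilon> \<Longrightarrow> E \<in> sets borel \<Longrightarrow>
    (\<integral>\<^sup>+x. (ennreal (norm (riesz_pot M s (E - cball x \<epsilon>) x)))\<^sup>2 \<partial>M) \<le> emeasure M E"
begin

text \<open>Superlevel set of a maximal transform over the radii \<delta>, 10\<delta>, 100\<delta>,
  and so on. The grid makes the union countable, is stable under tenfold enlargement, and is refined
  when \<delta> is divided by 10. The set \<open>E\<close> permits localisation to a ball.\<close>

definition level_set :: "'a set \<Rightarrow> real \<Rightarrow> real \<Rightarrow> 'a set" where
  "level_set E \<delta> t = {x. \<exists>k. t < norm (riesz_pot M s (E - cball x (10 ^ k * \<delta>)) x)}"

lemma level_set_measurable [measurable]:
  assumes [measurable]: "E \<in> sets borel"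
  shows "level_set E \<delta> t \<in> sets borel"
  unfolding level_set_def by measurable

text \<open>A truncation at radius r is at most the total mass times r^(-s), so it can be large only
  at bounded radii. This bounds the Vitali radii and leaves finitely many bad scales.\<close>

lemma radius_bound:
  assumes E: "E \<in> sets borel" and r: "0 < r" and u: "0 < u" "u < norm (riesz_pot M s (E - cball x r) x)"
  shows "r \<le> (measure M UNIV / u) powr (1 / s)"
proof -
  have "norm (riesz_pot M s (E - cball x r) x) \<le> measure M (E - cball x r) * r powr (- s)"
    by (rule norm_riesz_pot_le) (use E r in auto)
  also have "\<dots> \<le> measure M UNIV * r powr (- s)"
    by (intro mult_right_mono finite_measure_mono) (auto simp: sets_M)
  finally have "u \<le> measure M UNIV * r powr (- s)" using u by simp
  then have "r powr s \<le> measure M UNIV / u"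
    using r u by (simp add: powr_minus field_simps)
  then have "(r powr s) powr (1 / s) \<le> (measure M UNIV / u) powr (1 / s)"
    using s_pos by (intro powr_mono2) auto
  then show ?thesis using r s_pos by (simp add: powr_powr)
qed

lemma L2_bound_real:
  assumes "0 < \<epsilon>" "E \<in> sets borel"
  shows "integrable M (\<lambda>x. (norm (riesz_pot M s (E - cball x \<epsilon>) x))\<^sup>2)" (is ?I)
    and "(LINT x|M. (norm (riesz_pot M s (E - cball x \<epsilon>) x))\<^sup>2) \<le> measure M E"
proof -
  have le: "(\<integral>\<^sup>+x. ennreal ((norm (riesz_pot M s (E - cball x \<epsilon>) x))\<^sup>2) \<partial>M) \<le> ennreal (measure M E)"
    using L2_bound[OF assms] by (simp add: ennreal_power emeasure_eq_measure)
  show ?I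
    by (rule integrableI_bounded) (use assms le in \<open>auto intro: le_less_trans\<close>)
  then show "(LINT x|M. (norm (riesz_pot M s (E - cball x \<epsilon>) x))\<^sup>2) \<le> measure M E"
    using le by (subst (asm) nn_integral_eq_integral) auto
qed

text \<open>A weak form of Cotlar's inequality. On a doubling ball around a point of the level set the
  far part of the potential is nearly constant, hence it is large on the whole ball, and it differs
  from the \<open>\<delta>\<close>-truncation by the potential of the tenfold ball, which is controlled in \<open>L\<^sup>2\<close>.\<close>

lemma emeasure_level_set_le:
  assumes E [measurable]: "E \<in> sets borel" and \<delta>: "0 < \<delta>" and t: "cotlar_const s < t"
    and big: "8 * 10 powr s \<le> (t - cotlar_const s)\<^sup>2"
  shows "emeasure M (level_set E \<delta> t) \<le> ennreal (8 * 10 powr s / (t - cotlar_const s)\<^sup>2) * emeasure M E"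
proof -
  define D where "D = 2 * 10 powr s"
  define \<tau> where "\<tau> = t - cotlar_const s"
  have D: "D > 0" by (simp add: D_def)
  have \<tau>: "0 < \<tau>" "4 * D \<le> \<tau>\<^sup>2" using t big by (auto simp: \<tau>_def D_def)
  define g where "g = (\<lambda>x. (norm (riesz_pot M s (E - cball x \<delta>) x))\<^sup>2)"
  have g [measurable]: "g \<in> borel_measurable borel" unfolding g_def by measurable
  have gi: "integrable M g" unfolding g_def by (rule L2_bound_real) (use \<delta> in auto)
  \<comment> \<open>The sum of \<open>N\<close> over disjoint balls is at most the full integral of
    \<open>g\<close>, and the L2 bound for \<open>E\<close> controls that.\<close>
  define N where "N = density M (\<lambda>x. ennreal (g x))"
  have N_cball: "emeasure N A = ennreal (LINT x|M. g x * indicator A x)" if "A \<in> sets borel" for A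
  proof -
    have "emeasure N A = (\<integral>\<^sup>+x. ennreal (g x * indicator A x) \<partial>M)"
      unfolding N_def using that
      by (subst emeasure_density) (auto simp: sets_M g_def intro!: nn_integral_cong split: split_indicator)
    also have "\<dots> = ennreal (LINT x|M. g x * indicator A x)"
      by (rule nn_integral_eq_integral)
         (use that in \<open>auto simp: sets_M g_def gi[unfolded g_def] intro!: integrable_real_mult_indicator\<close>)
    finally show ?thesis .
  qed
  have "\<exists>R. 0 < R \<and> R \<le> (measure M UNIV / \<tau>) powr (1 / s)
      \<and> emeasure M (level_set E \<delta> t \<inter> cball x (5 * R)) \<le> ennreal (4 * D / \<tau>\<^sup>2) * emeasure N (cball x R)"
    if "x \<in> level_set E \<delta> t" for x
  proof -
    from that obtain k where k: "t < norm (riesz_pot M s (E - cball x (10 ^ k * \<delta>)) x)"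
      by (auto simp: level_set_def)
    define r where "r = 10 ^ k * \<delta>"
    have r: "0 < r" "\<delta> \<le> r" using \<delta> by (auto simp: r_def mult_le_cancel_right1)
    obtain j where j: "measure M (cball x (10 ^ Suc j * r)) \<le> 2 * 10 powr s * measure M (cball x (10 ^ j * r))"
      "norm (riesz_pot M s (E - cball x r) x - riesz_pot M s (E - cball x (10 ^ Suc j * r)) x) \<le> 3 * 20 powr s"
      using riesz_trunc_doubling[OF E r(1)] by blast
    define R where "R = 10 ^ j * r"
    have "r \<le> R" using r by (simp add: R_def mult_le_cancel_right1)
    with r have R: "0 < R" "\<delta> \<le> R" by auto
    have SR: "10 ^ Suc j * r = 10 * R" by (simp add: R_def)
    note j = j[unfolded SR, folded R_def D_def]
    let ?F = "E - cball x (10 * R)"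
    have far: "t - 3 * 20 powr s < norm (riesz_pot M s ?F x)"
      using k[folded r_def] j(2) norm_triangle_ineq2[of "riesz_pot M s (E - cball x r) x" "riesz_pot M s ?F x"]
      by linarith
    have "t - 3 * 20 powr s \<ge> \<tau>" using osc_const_nonneg[OF s_pos] by (simp add: \<tau>_def cotlar_const_def)
    then have "10 * R \<le> (measure M UNIV / \<tau>) powr (1 / s)"
      using far \<tau> R by (intro radius_bound[OF E, of "10 * R" \<tau> x]) auto
    then have RB: "R \<le> (measure M UNIV / \<tau>) powr (1 / s)" using R by linarith
    \<comment> \<open>Squared potential of the tenfold ball alone. Its integral is at most the mass
      of that ball, which doubling compares with the mass of \<open>cball x R\<close>.\<close>
    define h where "h = (\<lambda>y. (norm (riesz_pot M s ((E \<inter> cball x (10 * R)) - cball y \<delta>) y))\<^sup>2)"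
    have hi: "integrable M h" "(LINT y|M. h y) \<le> measure M (E \<inter> cball x (10 * R))"
      unfolding h_def using L2_bound_real[OF \<delta>, of "E \<inter> cball x (10 * R)"] by auto
    have pt: "\<tau>\<^sup>2 \<le> 2 * g y + 2 * h y" if "y \<in> cball x R" for y
    proof -
      have near: "10 * R - R \<le> dist y z" if "z \<in> ?F" for z
        using that \<open>y \<in> cball x R\<close> dist_triangle[of x z y] by auto
      have "norm (riesz_pot M s ?F x - riesz_pot M s ?F y) \<le> osc_const s"
        by (rule riesz_pot_osc[of _ "10 * R"]) (use R \<open>y \<in> cball x R\<close> in auto)
      then have "\<tau> \<le> norm (riesz_pot M s ?F y)"
        using far norm_triangle_ineq2[of "riesz_pot M s ?F x" "riesz_pot M s ?F y"]
        by (simp add: \<tau>_def cotlar_const_def)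
      also have "riesz_pot M s ?F y = riesz_pot M s (E - cball y \<delta>) y
          - riesz_pot M s ((E \<inter> cball x (10 * R)) - cball y \<delta>) y"
      proof -
        \<comment> \<open>Points outside the tenfold ball have distance at least 9R > \<delta> from
          \<open>y\<close>, so the ball removed around \<open>y\<close> takes nothing from
          \<open>?F\<close>.\<close>
        have "riesz_pot M s ?F y = riesz_pot M s ((E - cball y \<delta>) - ((E \<inter> cball x (10 * R)) - cball y \<delta>)) y"
          using near R by (intro arg_cong[where f = "\<lambda>S. riesz_pot M s S y"]) force
        also have "\<dots> = riesz_pot M s (E - cball y \<delta>) y - riesz_pot M s ((E \<inter> cball x (10 * R)) - cball y \<delta>) y"
          by (rule riesz_pot_Diff[of _ _ \<delta>, symmetric]) (use \<delta> in auto)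
        finally show ?thesis .
      qed
      also have "norm \<dots> \<le> norm (riesz_pot M s (E - cball y \<delta>) y)
          + norm (riesz_pot M s ((E \<inter> cball x (10 * R)) - cball y \<delta>) y)"
        by (rule norm_triangle_ineq4)
      finally have "\<tau>\<^sup>2 \<le> (norm (riesz_pot M s (E - cball y \<delta>) y)
          + norm (riesz_pot M s ((E \<inter> cball x (10 * R)) - cball y \<delta>) y))\<^sup>2"
        using \<tau> by (intro power_mono) auto
      also have "\<dots> \<le> 2 * g y + 2 * h y"
        unfolding g_def h_def using sum_squares_bound[of "norm (riesz_pot M s (E - cball y \<delta>) y)" "norm (riesz_pot M s ((E \<inter> cball x (10 * R)) - cball y \<delta>) y)"] by (simp add: power2_sum)
      finally show ?thesis .
    qed
    have gB: "integrable M (\<lambda>y. g y * indicator (cball x R) y)"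
      using gi by (intro integrable_real_mult_indicator) (auto simp: sets_M)
    have "\<tau>\<^sup>2 * measure M (cball x R) = (LINT y|M. \<tau>\<^sup>2 * indicator (cball x R) y)"
      by (simp add: sets_M)
    also have "\<dots> \<le> (LINT y|M. 2 * (g y * indicator (cball x R) y) + 2 * h y)"
    proof (rule integral_mono)
      show "integrable M (\<lambda>y. \<tau>\<^sup>2 * indicator (cball x R) y :: real)"
        by (intro integrable_mult_right integrable_real_indicator) (auto simp: sets_M less_top[symmetric])
      show "integrable M (\<lambda>y. 2 * (g y * indicator (cball x R) y) + 2 * h y)"
        using gB hi by auto
      show "\<tau>\<^sup>2 * indicator (cball x R) y \<le> 2 * (g y * indicator (cball x R) y) + 2 * h y" for y
        using pt[of y] by (auto simp: h_def split: split_indicator)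
    qed
    also have "\<dots> = 2 * (LINT y|M. g y * indicator (cball x R) y) + 2 * (LINT y|M. h y)"
      using gB hi by simp
    also have "(LINT y|M. h y) \<le> D * measure M (cball x R)"
      using hi(2) j(1) finite_measure_mono[of "E \<inter> cball x (10 * R)" "cball x (10 * R)"] by (auto simp: sets_M)
    finally have "\<tau>\<^sup>2 * measure M (cball x R)
        \<le> 2 * (LINT y|M. g y * indicator (cball x R) y) + 2 * D * measure M (cball x R)" by simp
    \<comment> \<open>The hypothesis \<open>big\<close> is used here: the local term is at most half
      of the left side and is absorbed, which turns the factor 2 into 4.\<close>
    moreover have "4 * D * measure M (cball x R) \<le> \<tau>\<^sup>2 * measure M (cball x R)"
      using \<tau> by (intro mult_right_mono) auto
    ultimately have *: "\<tau>\<^sup>2 * measure M (cball x R) \<le> 4 * (LINT y|M. g y * indicator (cball x R) y)"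
      by simp
    have "measure M (level_set E \<delta> t \<inter> cball x (5 * R)) \<le> measure M (cball x (10 * R))"
      using R by (intro finite_measure_mono) (auto simp: sets_M)
    also have "\<dots> \<le> D * measure M (cball x R)" by (rule j(1))
    also have "\<dots> \<le> D * (4 * (LINT y|M. g y * indicator (cball x R) y) / \<tau>\<^sup>2)"
      using * \<tau> D by (intro mult_left_mono) (auto simp: field_simps)
    also have "\<dots> = 4 * D / \<tau>\<^sup>2 * (LINT y|M. g y * indicator (cball x R) y)"
      by simp
    finally have "emeasure M (level_set E \<delta> t \<inter> cball x (5 * R))
        \<le> ennreal (4 * D / \<tau>\<^sup>2) * emeasure N (cball x R)"
      using D by (simp add: emeasure_eq_measure N_cball ennreal_leI flip: ennreal_mult')
    with R RB show ?thesis by blast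
  qed
  then obtain R where R: "\<And>x. x \<in> level_set E \<delta> t \<Longrightarrow> 0 < R x \<and> R x \<le> (measure M UNIV / \<tau>) powr (1 / s)
      \<and> emeasure M (level_set E \<delta> t \<inter> cball x (5 * R x)) \<le> ennreal (4 * D / \<tau>\<^sup>2) * emeasure N (cball x (R x))"
    by metis
  have "emeasure M (level_set E \<delta> t) \<le> ennreal (4 * D / \<tau>\<^sup>2) * emeasure N UNIV"
    by (rule emeasure_le_by_Vitali[of M N _ R]) (use R in \<open>auto simp: N_def sets_M\<close>)
  also have "\<dots> \<le> ennreal (4 * D / \<tau>\<^sup>2) * emeasure M E"
    using L2_bound_real(2)[OF \<delta> E] by (intro mult_left_mono) (auto simp: N_cball emeasure_eq_measure g_def)
  finally show ?thesis by (simp add: D_def \<tau>_def)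
qed


text \<open>Around each point of the upper level set we take the largest scale at which the truncation
  is large and enlarge it to a doubling ball. Its size puts the whole ball into the lower level set,
  and by maximality only the potential of the tenfold ball can still be large nearby.\<close>

lemma good_lambda_ball:
  assumes \<delta>: "0 < \<delta>" and \<theta>: "0 \<le> \<theta>" and x: "x \<in> level_set UNIV \<delta> (\<theta> + jump_const s)"
  shows "\<exists>R. 0 < R \<and> R \<le> (measure M UNIV / (osc_const s + 2 * 4 powr s)) powr (1 / s)
    \<and> cball x R \<subseteq> level_set UNIV \<delta> \<theta>
    \<and> emeasure M (level_set UNIV \<delta> (\<theta> + jump_const s) \<inter> cball x (5 * R))
        \<le> ennreal (1 / 32) * emeasure M (cball x R)"
proof -
  let ?T = "\<lambda>r x. riesz_pot M s (UNIV - cball x r) x"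
  have pos: "0 < 20 powr s" "0 < 4 powr s" "0 < 10 powr s" "0 \<le> osc_const s"
    using osc_const_nonneg[OF s_pos] by auto
  have sc: "0 < step_const s" by (rule step_const_pos[OF s_pos])
  \<comment> \<open>Of the margin \<open>step_const\<close>, the enlargement to a doubling scale
    spends \<open>3 * 20 powr s\<close>; the remainder pays for moving the centre anywhere in the
    ball.\<close>
  define K where "K = {k. \<theta> + step_const s < norm (?T (10 ^ k * \<delta>) x)}"
  have bd: "10 ^ k * \<delta> \<le> (measure M UNIV / step_const s) powr (1 / s)" if "k \<in> K" for k
    by (rule radius_bound[of UNIV _ "step_const s" x]) (use that \<delta> \<theta> sc in \<open>auto simp: K_def\<close>)
  have "finite K"
  proof -
    obtain n where n: "(measure M UNIV / step_const s) powr (1 / s) / \<delta> < 10 ^ n"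
      using real_arch_pow[of 10] by auto
    have "k < n" if "k \<in> K" for k
    proof -
      have "10 ^ k \<le> (measure M UNIV / step_const s) powr (1 / s) / \<delta>"
        using bd[OF that] \<delta> by (simp add: field_simps)
      then have "(10::real) ^ k < 10 ^ n" using n by linarith
      then show ?thesis by simp
    qed
    then show ?thesis by (meson finite_nat_iff_bounded lessThan_iff subsetI)
  qed
  have "step_const s \<le> jump_const s"
    using pos sc by (simp add: jump_const_def cotlar_const_def)
  then have "K \<noteq> {}"
    using x unfolding K_def level_set_def by (smt (verit) empty_iff mem_Collect_eq)
  define k where "k = Max K"
  have k: "k \<in> K" and kmax: "\<And>i. k < i \<Longrightarrow> i \<notin> K"
    using \<open>finite K\<close> \<open>K \<noteq> {}\<close> Max_ge[OF \<open>finite K\<close>] by (auto simp: k_def dest: leD)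
  define r where "r = 10 ^ k * \<delta>"
  have r: "0 < r" using \<delta> by (simp add: r_def)
  obtain j where j: "measure M (cball x (10 ^ Suc j * r)) \<le> 2 * 10 powr s * measure M (cball x (10 ^ j * r))"
    "norm (?T r x - ?T (10 ^ Suc j * r) x) \<le> 3 * 20 powr s"
    using riesz_trunc_doubling[of UNIV r x] r by auto
  define R where "R = 10 ^ j * r"
  have R: "0 < R" using r by (simp add: R_def)
  have SR: "10 ^ Suc j * r = 10 * R" by (simp add: R_def)
  have R_scale: "10 * R = 10 ^ (k + Suc j) * \<delta>" "R = 10 ^ (k + j) * \<delta>"
    by (simp_all add: R_def r_def power_add)
  note j = j[unfolded SR, folded R_def]
  have big: "\<theta> + osc_const s + 2 * 4 powr s < norm (?T (10 * R) x)"
    using k j(2) norm_triangle_ineq2[of "?T r x" "?T (10 * R) x"]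
    by (simp add: K_def step_const_def flip: r_def)
  have "10 * R \<le> (measure M UNIV / (osc_const s + 2 * 4 powr s)) powr (1 / s)"
  proof (rule radius_bound[of UNIV _ _ x])
    show "0 < osc_const s + 2 * 4 powr s" using pos by linarith
  qed (use big R \<theta> in auto)
  then have RB: "R \<le> (measure M UNIV / (osc_const s + 2 * 4 powr s)) powr (1 / s)"
    using R by linarith
  have sub: "cball x R \<subseteq> level_set UNIV \<delta> \<theta>"
  proof
    fix y assume y: "y \<in> cball x R"
    have "norm (?T (10 * R) x - ?T (10 * R) y) \<le> osc_const s + 2 * 4 powr s"
      by (rule riesz_trunc_osc) (use R y in auto)
    then have "\<theta> < norm (?T (10 * R) y)"
      using big norm_triangle_ineq2[of "?T (10 * R) x" "?T (10 * R) y"] by linarith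
    then show "y \<in> level_set UNIV \<delta> \<theta>"
      unfolding level_set_def R_scale(1) by blast
  qed
  let ?t = "cotlar_const s + 32 * 10 powr s"
  have "level_set UNIV \<delta> (\<theta> + jump_const s) \<inter> cball x (5 * R) \<subseteq> level_set (cball x (10 * R)) \<delta> ?t"
  proof
    fix y assume y: "y \<in> level_set UNIV \<delta> (\<theta> + jump_const s) \<inter> cball x (5 * R)"
    then obtain i where i: "\<theta> + jump_const s < norm (?T (10 ^ i * \<delta>) y)"
      by (auto simp: level_set_def)
    define \<rho> where "\<rho> = 10 ^ i * \<delta>"
    have \<rho>: "0 < \<rho>" using \<delta> by (simp add: \<rho>_def)
    \<comment> \<open>Beyond the enlarged scale the truncation at \<open>x\<close> is at most
      \<theta> + \<open>step_const\<close> by maximality of \<open>k\<close>. Moving the centre to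
      \<open>y\<close> costs at most one more \<open>step_const\<close>, which falls short of the
      jump.\<close>
    have i_le: "i \<le> k + j"
    proof (rule ccontr)
      assume "\<not> i \<le> k + j"
      then have i': "k + Suc j \<le> i" by simp
      then have "10 * R \<le> \<rho>"
        unfolding \<rho>_def R_scale(1) using \<delta> by (intro mult_right_mono power_increasing) auto
      then have "norm (?T \<rho> x - ?T \<rho> y) \<le> osc_const s + 2 * 4 powr s"
        by (intro riesz_trunc_osc) (use \<rho> y in auto)
      moreover have "norm (?T \<rho> x) \<le> \<theta> + step_const s"
        using kmax[of i] i' by (simp add: K_def \<rho>_def)
      moreover have "norm (?T \<rho> y) \<le> norm (?T \<rho> x) + norm (?T \<rho> x - ?T \<rho> y)"
        by (metis norm_minus_commute norm_triangle_sub)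
      moreover have "step_const s + (osc_const s + 2 * 4 powr s) \<le> jump_const s"
      proof -
        have "osc_const s + 2 * 4 powr s \<le> step_const s" by (simp add: step_const_def)
        moreover have "0 \<le> cotlar_const s" using pos by (simp add: cotlar_const_def)
        ultimately show ?thesis using pos(3) unfolding jump_const_def by linarith
      qed
      ultimately have "norm (?T \<rho> y) \<le> \<theta> + jump_const s" by linarith
      then show False using i by (simp add: \<rho>_def)
    qed
    have \<rho>R: "\<rho> \<le> R"
      unfolding \<rho>_def R_scale(2) using \<delta> i_le by (intro mult_right_mono power_increasing) auto
    have far: "5 * R \<le> dist y z" if "z \<notin> cball x (10 * R)" for z
      using that y dist_triangle[of x z y] by auto
    have "?T \<rho> y - riesz_pot M s (cball x (10 * R) - cball y \<rho>) y
        = riesz_pot M s ((UNIV - cball y \<rho>) - (cball x (10 * R) - cball y \<rho>)) y"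
      by (rule riesz_pot_Diff[of _ _ \<rho>]) (use \<rho> in auto)
    \<comment> \<open>As \<open>y\<close> is within 5R of \<open>x\<close> and \<rho> \<le> R, the
      ball \<open>cball y \<rho>\<close> lies in the tenfold ball, so the far part does not depend
      on \<rho>.\<close>
    also have "(UNIV - cball y \<rho>) - (cball x (10 * R) - cball y \<rho>) = UNIV - cball x (10 * R)"
      using far \<rho>R R by force
    finally have split: "?T \<rho> y = riesz_pot M s (cball x (10 * R) - cball y \<rho>) y
        + riesz_pot M s (UNIV - cball x (10 * R)) y"
      by (simp add: algebra_simps)
    have "norm (?T (10 * R) x - riesz_pot M s (UNIV - cball x (10 * R)) y) \<le> osc_const s"
      by (rule riesz_pot_osc[of _ "10 * R"]) (use R y in auto)
    moreover have "norm (?T (10 * R) x) \<le> \<theta> + step_const s"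
      using kmax[of "k + Suc j"] by (simp add: K_def R_scale(1))
    ultimately have far_le: "norm (riesz_pot M s (UNIV - cball x (10 * R)) y) \<le> \<theta> + step_const s + osc_const s"
      using norm_triangle_ineq3[of "?T (10 * R) x" "riesz_pot M s (UNIV - cball x (10 * R)) y"] by linarith
    have near_ge: "\<theta> + jump_const s \<le> norm (riesz_pot M s (cball x (10 * R) - cball y \<rho>) y)
        + norm (riesz_pot M s (UNIV - cball x (10 * R)) y)"
      using i norm_triangle_ineq[of "riesz_pot M s (cball x (10 * R) - cball y \<rho>) y"
          "riesz_pot M s (UNIV - cball x (10 * R)) y"]
      by (simp add: split flip: \<rho>_def)
    have "osc_const s < step_const s" using pos unfolding step_const_def by linarith
    with far_le near_ge have "?t < norm (riesz_pot M s (cball x (10 * R) - cball y \<rho>) y)"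
      unfolding jump_const_def by linarith
    then show "y \<in> level_set (cball x (10 * R)) \<delta> ?t"
      unfolding level_set_def \<rho>_def by blast
  qed
  then have "emeasure M (level_set UNIV \<delta> (\<theta> + jump_const s) \<inter> cball x (5 * R))
      \<le> emeasure M (level_set (cball x (10 * R)) \<delta> ?t)"
    by (intro emeasure_mono) (auto simp: sets_M)
  also have "\<dots> \<le> ennreal (8 * 10 powr s / (?t - cotlar_const s)\<^sup>2) * emeasure M (cball x (10 * R))"
  proof (rule emeasure_level_set_le)
    have "1 \<le> 10 powr s" using s_pos by (simp add: ge_one_powr_ge_zero)
    then show "8 * 10 powr s \<le> (?t - cotlar_const s)\<^sup>2"
      by (simp add: power2_eq_square)
  qed (use \<delta> pos in auto)
  also have "\<dots> = ennreal (8 * 10 powr s / (?t - cotlar_const s)\<^sup>2 * measure M (cball x (10 * R)))"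
    unfolding emeasure_eq_measure by (rule ennreal_mult[symmetric]) simp_all
  also have "\<dots> \<le> ennreal (8 * 10 powr s / (?t - cotlar_const s)\<^sup>2 * (2 * 10 powr s * measure M (cball x R)))"
    using j(1) by (intro ennreal_leI mult_left_mono) auto
  \<comment> \<open>The excess of \<open>?t\<close> over \<open>cotlar_const s\<close> is
    \<open>32 * 10 powr s\<close>, so the quotient of constants is 16/1024.\<close>
  also have "8 * 10 powr s / (?t - cotlar_const s)\<^sup>2 * (2 * 10 powr s * measure M (cball x R))
      = 1 / 64 * measure M (cball x R)"
    by (simp add: power2_eq_square)
  also have "ennreal (1 / 64 * measure M (cball x R)) \<le> ennreal (1 / 32 * measure M (cball x R))"
    by (intro ennreal_leI mult_right_mono) auto
  also have "\<dots> = ennreal (1 / 32) * emeasure M (cball x R)"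
    unfolding emeasure_eq_measure by (rule ennreal_mult) simp_all
  finally have "emeasure M (level_set UNIV \<delta> (\<theta> + jump_const s) \<inter> cball x (5 * R))
      \<le> ennreal (1 / 32) * emeasure M (cball x R)" .
  with R RB sub show ?thesis by blast
qed

text \<open>All the balls lie in the lower level set, so restricting the measure to that set turns
  the sum over disjoint balls into its mass.\<close>

lemma good_lambda:
  assumes \<delta>: "0 < \<delta>" and \<theta>: "0 \<le> \<theta>"
  shows "emeasure M (level_set UNIV \<delta> (\<theta> + jump_const s)) \<le> ennreal (1 / 32) * emeasure M (level_set UNIV \<delta> \<theta>)"
proof -
  let ?S = "level_set UNIV \<delta> (\<theta> + jump_const s)" and ?L = "level_set UNIV \<delta> \<theta>"
  define N where "N = density M (indicator ?L)"
  have [measurable]: "?L \<in> sets M" by (simp add: sets_M)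
  have N: "emeasure N A = emeasure M (?L \<inter> A)" if "A \<in> sets borel" for A
    using that by (simp add: N_def emeasure_restricted sets_M)
  obtain R where R: "\<And>x. x \<in> ?S \<Longrightarrow> 0 < R x \<and> R x \<le> (measure M UNIV / (osc_const s + 2 * 4 powr s)) powr (1 / s)
    \<and> cball x (R x) \<subseteq> ?L
    \<and> emeasure M (?S \<inter> cball x (5 * R x)) \<le> ennreal (1 / 32) * emeasure M (cball x (R x))"
    using good_lambda_ball[OF assms] by metis
  have "emeasure M ?S \<le> ennreal (1 / 32) * emeasure N UNIV"
  proof (rule emeasure_le_by_Vitali[of M N _ R])
    show "emeasure M (?S \<inter> cball x (5 * R x)) \<le> ennreal (1 / 32) * emeasure N (cball x (R x))"
      if "x \<in> ?S" for x
      using R[OF that] by (simp add: N Int_absorb1)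
  qed (use R in \<open>auto simp: N_def sets_M\<close>)
  then show ?thesis by (simp add: N)
qed

text \<open>Because each step adds a fixed height, levels in arithmetic progression have
  geometrically decaying mass, uniformly in \<delta>.\<close>

lemma emeasure_level_set_decay:
  assumes "0 < \<delta>"
  shows "emeasure M (level_set UNIV \<delta> (real n * jump_const s)) \<le> ennreal ((1 / 32) ^ n) * emeasure M UNIV"
proof (induction n)
  case 0
  then show ?case by (auto intro!: emeasure_mono simp: sets_M)
next
  case (Suc n)
  have "emeasure M (level_set UNIV \<delta> (real (Suc n) * jump_const s))
      \<le> ennreal (1 / 32) * emeasure M (level_set UNIV \<delta> (real n * jump_const s))"
    using good_lambda[OF assms, of "real n * jump_const s"] jump_const_pos[OF s_pos] by (simp add: algebra_simps)
  also have "\<dots> \<le> ennreal (1 / 32) * (ennreal ((1 / 32) ^ n) * emeasure M UNIV)"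
    by (rule mult_left_mono[OF Suc]) simp
  also have "\<dots> = ennreal ((1 / 32) ^ Suc n) * emeasure M UNIV"
  proof -
    have "ennreal ((1 / 32) ^ Suc n) = ennreal (1 / 32) * ennreal ((1 / 32) ^ n)"
      unfolding power_Suc by (rule ennreal_mult') simp
    then show ?thesis by (simp only: mult.assoc)
  qed
  finally show ?case .
qed

text \<open>Replacing a radius \<epsilon> by a grid radius r with r \<le> \<epsilon> < 10r costs at
  most (20r)^s r^(-s) = 20^s, which is the shift of the level. The grids refine as \<delta> runs
  through 10^(-m), so continuity of the measure from below removes \<delta>.\<close>

lemma emeasure_riesz_max_decay:
  "emeasure M {x. ennreal (real n * jump_const s + 20 powr s) < riesz_max M s x}
     \<le> ennreal ((1 / 32) ^ n) * emeasure M UNIV"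
proof -
  define \<tau> where "\<tau> = real n * jump_const s"
  define L where "L = (\<lambda>m. level_set UNIV (1 / 10 ^ m) \<tau>)"
  have "{x. ennreal (\<tau> + 20 powr s) < riesz_max M s x} \<subseteq> (\<Union>m. L m)"
  proof
    fix x assume "x \<in> {x. ennreal (\<tau> + 20 powr s) < riesz_max M s x}"
    then obtain \<epsilon> where "0 < \<epsilon>"
      "ennreal (\<tau> + 20 powr s) < ennreal (norm (riesz_pot M s (UNIV - cball x \<epsilon>) x))"
      by (auto simp only: riesz_max_def less_SUP_iff riesz_trunc_eq_pot Compl_eq_Diff_UNIV
          mem_Collect_eq greaterThan_iff)
    moreover have "0 \<le> \<tau> + 20 powr s" using jump_const_pos[OF s_pos] by (simp add: \<tau>_def)
    ultimately have \<epsilon>: "0 < \<epsilon>" "\<tau> + 20 powr s < norm (riesz_pot M s (UNIV - cball x \<epsilon>) x)"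
      by (simp_all only: ennreal_less_iff)
    obtain m where m: "1 / 10 ^ m \<le> \<epsilon>"
      using real_arch_pow_inv[of \<epsilon> "1/10"] \<epsilon> by (auto simp: power_one_over intro: less_imp_le)
    \<comment> \<open>Minimality places \<epsilon> in one grid interval: the radius with index
      \<open>k\<close> is at most \<epsilon>, for \<open>k = 0\<close> by the choice of
      \<open>m\<close>.\<close>
    define k where "k = (LEAST k. \<epsilon> < 10 ^ Suc k * (1 / 10 ^ m))"
    have ex: "\<exists>k. \<epsilon> < 10 ^ Suc k * (1 / 10 ^ m)"
    proof -
      obtain k where "\<epsilon> * 10 ^ m < 10 ^ k" using real_arch_pow[of 10] by auto
      also have "(10::real) ^ k \<le> 10 ^ Suc k" by simp
      finally show ?thesis by (intro exI[of _ k]) (simp add: field_simps)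
    qed
    have k: "\<epsilon> < 10 ^ Suc k * (1 / 10 ^ m)" unfolding k_def by (rule LeastI_ex[OF ex])
    define r where "r = 10 ^ k * (1 / 10 ^ m :: real)"
    have r: "0 < r" "\<epsilon> < 10 * r" using k by (auto simp: r_def)
    have "r \<le> \<epsilon>"
    proof (cases k)
      case 0
      then show ?thesis using m by (simp add: r_def)
    next
      case (Suc l)
      then have "\<not> \<epsilon> < 10 ^ Suc l * (1 / 10 ^ m)"
        using not_less_Least[of l "\<lambda>k. \<epsilon> < 10 ^ Suc k * (1 / 10 ^ m)"] by (simp add: k_def)
      then show ?thesis using Suc by (simp add: r_def)
    qed
    have "norm (riesz_pot M s (UNIV - cball x r) x - riesz_pot M s (UNIV - cball x \<epsilon>) x)
        \<le> measure M (cball x \<epsilon>) * r powr (- s)"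
      by (rule riesz_pot_scale) (use r \<open>r \<le> \<epsilon>\<close> in auto)
    also have "\<dots> \<le> (20 * r) powr s * r powr (- s)"
    proof (intro mult_right_mono)
      have "measure M (cball x \<epsilon>) \<le> (2 * \<epsilon>) powr s" by (rule measure_cball_le) fact
      also have "\<dots> \<le> (20 * r) powr s" using r \<epsilon> s_pos by (intro powr_mono2) auto
      finally show "measure M (cball x \<epsilon>) \<le> (20 * r) powr s" .
    qed auto
    also have "\<dots> = 20 powr s" using r by (simp add: powr_mult powr_minus)
    finally have "\<tau> < norm (riesz_pot M s (UNIV - cball x r) x)"
      using \<epsilon> norm_triangle_ineq3[of "riesz_pot M s (UNIV - cball x r) x" "riesz_pot M s (UNIV - cball x \<epsilon>) x"]
      by linarith
    then have "x \<in> L m" unfolding L_def level_set_def r_def by blast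
    then show "x \<in> (\<Union>m. L m)" by blast
  qed
  then have "emeasure M {x. ennreal (\<tau> + 20 powr s) < riesz_max M s x} \<le> emeasure M (\<Union>m. L m)"
    by (intro emeasure_mono) (auto simp: L_def sets_M)
  also have "\<dots> = (SUP m. emeasure M (L m))"
  proof (rule SUP_emeasure_incseq[symmetric])
    show "incseq L"
    proof (rule incseq_SucI)
      fix m
      \<comment> \<open>Index \<open>k\<close> on the old grid is index \<open>Suc k\<close> on the
        finer one.\<close>
      have "(10 ^ k * (1 / 10 ^ m) :: real) = 10 ^ Suc k * (1 / 10 ^ Suc m)" for k by simp
      then show "L m \<subseteq> L (Suc m)" unfolding L_def level_set_def by (smt (verit) mem_Collect_eq subsetI)
    qed
  qed (auto simp: L_def sets_M)
  also have "\<dots> \<le> ennreal ((1 / 32) ^ n) * emeasure M UNIV"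
    unfolding L_def \<tau>_def by (intro SUP_least emeasure_level_set_decay) simp
  finally show ?thesis by (simp add: \<tau>_def)
qed

end

section \<open>Measurability and the fourth moment\<close>

lemma rational_right_above:
  fixes h :: "real \<Rightarrow> real"
  assumes "(h \<longlongrightarrow> h \<epsilon>) (at_right \<epsilon>)" "c < h \<epsilon>" "\<epsilon> < b"
  shows "\<exists>q\<in>\<rat>. \<epsilon> < q \<and> q < b \<and> c < h q"
proof -
  have "eventually (\<lambda>q. c < h q) (at_right \<epsilon>)"
    using assms by (intro order_tendstoD)
  then obtain b' where b': "b' > \<epsilon>" "\<And>q. \<epsilon> < q \<Longrightarrow> q < b' \<Longrightarrow> c < h q"
    by (auto simp: eventually_at_right_field)
  obtain q where "q \<in> \<rat>" "\<epsilon> < q" "q < min b b'"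
    using Rats_dense_in_real[of \<epsilon> "min b b'"] assms b' by auto
  with b' show ?thesis by auto
qed

lemma filterlim_inverse_Suc_at_right_0: "filterlim (\<lambda>n. 1 / real (Suc n)) (at_right 0) sequentially"
  unfolding filterlim_at using LIMSEQ_inverse_real_of_nat by (auto simp: inverse_eq_divide)

text \<open>The candidate limit is read off along 1/(n+1). If that sequence diverges,
  \<open>lim\<close> is unspecified, which does no harm: the right side forces convergence to its
  value. The inequality at rational radii is not strict, and right continuity carries it to all
  radii.\<close>

lemma at_right_limit_iff_rational:
  fixes g :: "real \<Rightarrow> 'a::real_normed_vector"
  assumes cont: "\<And>\<epsilon>. 0 < \<epsilon> \<Longrightarrow> (g \<longlongrightarrow> g \<epsilon>) (at_right \<epsilon>)"
  shows "(\<exists>l. (g \<longlongrightarrow> l) (at_right 0)) \<longleftrightarrow>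
    (\<forall>n. \<exists>m. \<forall>q\<in>\<rat>. 0 < q \<longrightarrow> q < 1 / real (Suc m) \<longrightarrow>
       dist (g q) (lim (\<lambda>n. g (1 / real (Suc n)))) \<le> 1 / real (Suc n))"
    (is "_ \<longleftrightarrow> (\<forall>n. \<exists>m. ?Q n m)")
proof
  let ?l = "lim (\<lambda>n. g (1 / real (Suc n)))"
  assume "\<exists>l. (g \<longlongrightarrow> l) (at_right 0)"
  then obtain l where l: "(g \<longlongrightarrow> l) (at_right 0)" by blast
  have "?l = l"
    by (intro limI filterlim_compose[OF l filterlim_inverse_Suc_at_right_0])
  show "\<forall>n. \<exists>m. ?Q n m"
  proof
    fix n
    have "eventually (\<lambda>q. dist (g q) l < 1 / real (Suc n)) (at_right 0)"
      using l by (rule tendstoD) simp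
    then obtain b where b: "b > 0" "\<And>q. 0 < q \<Longrightarrow> q < b \<Longrightarrow> dist (g q) l < 1 / real (Suc n)"
      by (auto simp: eventually_at_right_field)
    obtain m where "1 / real (Suc m) < b"
      using reals_Archimedean[OF b(1)] by (auto simp: inverse_eq_divide)
    then show "\<exists>m. ?Q n m"
      unfolding \<open>?l = l\<close> using b(2) by (intro exI[of _ m]) (auto intro: less_imp_le)
  qed
next
  let ?l = "lim (\<lambda>n. g (1 / real (Suc n)))"
  assume Q: "\<forall>n. \<exists>m. ?Q n m"
  have "(g \<longlongrightarrow> ?l) (at_right 0)"
  proof (rule tendstoI)
    fix e :: real assume "e > 0"
    then obtain n where n: "1 / real (Suc n) < e"
      using reals_Archimedean by (auto simp: inverse_eq_divide)
    obtain m where m: "?Q n m" using Q by blast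
    have "dist (g \<epsilon>) ?l \<le> 1 / real (Suc n)" if \<epsilon>: "0 < \<epsilon>" "\<epsilon> < 1 / real (Suc m)" for \<epsilon>
    proof (rule ccontr)
      assume "\<not> ?thesis"
      then obtain q where "q \<in> \<rat>" "\<epsilon> < q" "q < 1 / real (Suc m)" "1 / real (Suc n) < dist (g q) ?l"
        using rational_right_above[of "\<lambda>q. dist (g q) ?l" \<epsilon> "1 / real (Suc n)" "1 / real (Suc m)"]
          tendsto_dist[OF cont[OF \<epsilon>(1)] tendsto_const] \<epsilon> by auto
      then show False using m \<epsilon> by (metis less_trans not_le)
    qed
    then have "dist (g \<epsilon>) ?l < e" if "0 < \<epsilon>" "\<epsilon> < 1 / real (Suc m)" for \<epsilon>
      using that n by fastforce
    then show "eventually (\<lambda>q. dist (g q) ?l < e) (at_right 0)"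
      unfolding eventually_at_right_field by (intro exI[of _ "1 / real (Suc m)"]) auto
  qed
  then show "\<exists>l. (g \<longlongrightarrow> l) (at_right 0)" by blast
qed

section \<open>Borel measurability of the limit and of the maximal transform\<close>

context growth_measure
begin

text \<open>When the radius decreases to \<epsilon>, the open exteriors increase to the one at
  \<epsilon>, and the kernel is dominated there by a constant. Spheres may carry mass, so only
  continuity from the right is claimed.\<close>

lemma riesz_trunc_right_continuous:
  assumes \<epsilon>: "0 < \<epsilon>"
  shows "((\<lambda>r. riesz_trunc M s r x) \<longlongrightarrow> riesz_trunc M s \<epsilon> x) (at_right \<epsilon>)"
proof (rule tendsto_at_right_sequentially[of \<epsilon> "\<epsilon> + 1"])
  fix S :: "nat \<Rightarrow> real"
  assume S: "\<And>n. \<epsilon> < S n" "S \<longlonglongrightarrow> \<epsilon>"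
  show "(\<lambda>n. riesz_trunc M s (S n) x) \<longlonglongrightarrow> riesz_trunc M s \<epsilon> x"
    unfolding riesz_trunc_eq_pot riesz_pot_def set_lebesgue_integral_def
  proof (rule integral_dominated_convergence[where w = "\<lambda>_. \<epsilon> powr (- s)"])
    show "AE y in M. (\<lambda>n. indicator (- cball x (S n)) y *\<^sub>R riesz_kernel s (y - x))
        \<longlonglongrightarrow> indicator (- cball x \<epsilon>) y *\<^sub>R riesz_kernel s (y - x)"
    proof (intro always_eventually allI)
      fix y
      show "(\<lambda>n. indicator (- cball x (S n)) y *\<^sub>R riesz_kernel s (y - x))
        \<longlonglongrightarrow> indicator (- cball x \<epsilon>) y *\<^sub>R riesz_kernel s (y - x)"
      proof (cases "\<epsilon> < dist x y")
        case True
        have "eventually (\<lambda>n. S n < dist x y) sequentially"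
          using S(2) True by (rule order_tendstoD)
        then have "eventually (\<lambda>n. indicator (- cball x (S n)) y *\<^sub>R riesz_kernel s (y - x)
            = indicator (- cball x \<epsilon>) y *\<^sub>R riesz_kernel s (y - x)) sequentially"
          by eventually_elim (use True in auto)
        then show ?thesis by (rule tendsto_eventually)
      next
        case False
        have "dist x y \<le> S n" for n using False S(1)[of n] by simp
        then show ?thesis using False by simp
      qed
    qed
    show "AE y in M. norm (indicator (- cball x (S n)) y *\<^sub>R riesz_kernel s (y - x)) \<le> \<epsilon> powr (- s)" for n
    proof (intro always_eventually allI)
      fix y
      show "norm (indicator (- cball x (S n)) y *\<^sub>R riesz_kernel s (y - x)) \<le> \<epsilon> powr (- s)"
        using S(1)[of n] \<epsilon> s_pos
        by (auto simp: norm_riesz_kernel indicator_def dist_norm norm_minus_commute intro!: powr_mono2')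
    qed
  qed measurable
qed simp

lemma measurable_riesz_trunc [measurable]: "riesz_trunc M s \<epsilon> \<in> borel_measurable borel"
  using measurable_riesz_pot[of UNIV \<epsilon>] unfolding riesz_trunc_eq_pot[abs_def] Compl_eq_Diff_UNIV by simp

text \<open>Right continuity finds a rational radius that exceeds any value below the truncation; a
  countable supremum is measurable.\<close>

lemma riesz_max_eq_SUP_rational:
  "riesz_max M s x = (SUP q\<in>{0<..} \<inter> \<rat>. ennreal (norm (riesz_trunc M s q x)))"
proof (rule antisym)
  show "riesz_max M s x \<le> (SUP q\<in>{0<..} \<inter> \<rat>. ennreal (norm (riesz_trunc M s q x)))"
    unfolding riesz_max_def
  proof (rule SUP_least)
    fix \<epsilon> :: real assume \<epsilon>: "\<epsilon> \<in> {0<..}"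
    show "ennreal (norm (riesz_trunc M s \<epsilon> x)) \<le> (SUP q\<in>{0<..} \<inter> \<rat>. ennreal (norm (riesz_trunc M s q x)))"
    proof (rule dense_le)
      fix y assume y: "y < ennreal (norm (riesz_trunc M s \<epsilon> x))"
      then obtain c where c: "0 \<le> c" "y = ennreal c" by (cases y) auto
      then have "c < norm (riesz_trunc M s \<epsilon> x)" using y by (simp add: ennreal_less_iff)
      then obtain q where q: "q \<in> \<rat>" "\<epsilon> < q" "c < norm (riesz_trunc M s q x)"
        using rational_right_above[of "\<lambda>q. norm (riesz_trunc M s q x)" \<epsilon> c "\<epsilon> + 1"]
          tendsto_norm[OF riesz_trunc_right_continuous[of \<epsilon> x]] \<epsilon> by auto
      then have "y \<le> ennreal (norm (riesz_trunc M s q x))" using c by (simp add: ennreal_leI)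
      also have "\<dots> \<le> (SUP q\<in>{0<..} \<inter> \<rat>. ennreal (norm (riesz_trunc M s q x)))"
        using q \<epsilon> by (intro SUP_upper) auto
      finally show "y \<le> (SUP q\<in>{0<..} \<inter> \<rat>. ennreal (norm (riesz_trunc M s q x)))" .
    qed
  qed
  show "(SUP q\<in>{0<..} \<inter> \<rat>. ennreal (norm (riesz_trunc M s q x))) \<le> riesz_max M s x"
    unfolding riesz_max_def by (rule SUP_subset_mono) auto
qed

lemma measurable_riesz_max [measurable]: "riesz_max M s \<in> borel_measurable borel"
  unfolding riesz_max_eq_SUP_rational[abs_def]
  by (rule borel_measurable_SUP) (auto intro: countable_Int2 countable_rat)

text \<open>The set where the limit exists is described by rational radii, hence Borel. On it the
  transform is a sequential limit; off it \<open>Lim\<close> unfolds to \<open>THE l. False\<close>,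
  one constant for all points.\<close>

lemma measurable_riesz [measurable]: "riesz M s \<in> borel_measurable borel"
proof -
  define L where "L = (\<lambda>x. lim (\<lambda>n. riesz_trunc M s (1 / real (Suc n)) x))"
  have L [measurable]: "L \<in> borel_measurable borel"
    unfolding L_def by (rule borel_measurable_lim_metric) simp
  have ex: "riesz_exists M s x \<longleftrightarrow> (\<forall>n. \<exists>m. \<forall>q\<in>\<rat>. 0 < q \<longrightarrow> q < 1 / real (Suc m) \<longrightarrow>
       dist (riesz_trunc M s q x) (L x) \<le> 1 / real (Suc n))" for x
    unfolding riesz_exists_def L_def
    by (rule at_right_limit_iff_rational) (rule riesz_trunc_right_continuous)
  have [measurable]: "Measurable.pred borel (riesz_exists M s)"
    unfolding ex[abs_def]
  proof (intro pred_intros_countable)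
    fix n m
    have "Measurable.pred borel (\<lambda>x. \<forall>q :: rat. 0 < real_of_rat q \<longrightarrow> real_of_rat q < 1 / real (Suc m) \<longrightarrow>
       dist (riesz_trunc M s (real_of_rat q) x) (L x) \<le> 1 / real (Suc n))"
      by measurable
    then show "Measurable.pred borel (\<lambda>x. \<forall>q\<in>\<rat>. 0 < q \<longrightarrow> q < 1 / real (Suc m) \<longrightarrow>
       dist (riesz_trunc M s q x) (L x) \<le> 1 / real (Suc n))"
      by (simp only: Rats_def ball_simps)
  qed
  have eq: "riesz M s x = (if riesz_exists M s x then L x else (THE l. False))" for x
  proof (cases "riesz_exists M s x")
    case True
    then obtain l where l: "((\<lambda>\<epsilon>. riesz_trunc M s \<epsilon> x) \<longlongrightarrow> l) (at_right 0)"
      by (auto simp: riesz_exists_def)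
    have "L x = l"
      unfolding L_def by (intro limI filterlim_compose[OF l filterlim_inverse_Suc_at_right_0])
    moreover have "riesz M s x = l"
      unfolding riesz_def using l by (intro tendsto_Lim) auto
    ultimately show ?thesis using True by simp
  next
    case False
    then have "(\<lambda>l. ((\<lambda>\<epsilon>. riesz_trunc M s \<epsilon> x) \<longlongrightarrow> l) (at_right 0)) = (\<lambda>l. False)"
      by (auto simp: riesz_exists_def)
    with False show ?thesis by (simp add: riesz_def t2_space_class.Lim_def)
  qed
  show ?thesis unfolding eq[abs_def] by measurable
qed

lemma norm_riesz_le_riesz_max:
  assumes "riesz_exists M s x"
  shows "ennreal (norm (riesz M s x)) \<le> riesz_max M s x"
proof -
  from assms obtain l where l: "((\<lambda>\<epsilon>. riesz_trunc M s \<epsilon> x) \<longlongrightarrow> l) (at_right 0)"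
    by (auto simp: riesz_exists_def)
  have "riesz M s x = l"
    unfolding riesz_def using l by (intro tendsto_Lim) auto
  moreover have "ennreal (norm l) \<le> riesz_max M s x"
  proof (rule tendsto_upperbound)
    show "((\<lambda>\<epsilon>. ennreal (norm (riesz_trunc M s \<epsilon> x))) \<longlongrightarrow> ennreal (norm l)) (at_right 0)"
      using l by (intro tendsto_ennrealI tendsto_norm)
    show "eventually (\<lambda>\<epsilon>. ennreal (norm (riesz_trunc M s \<epsilon> x)) \<le> riesz_max M s x) (at_right 0)"
      using eventually_at_right_less[of 0]
      by eventually_elim (auto simp: riesz_max_def intro: SUP_upper)
  qed simp
  ultimately show ?thesis by simp
qed

end

section \<open>The fourth moment of the maximal transform\<close>

definition moment_const :: "real \<Rightarrow> real" where
  "moment_const s = 3 * (jump_const s + 20 powr s) ^ 4"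

lemma moment_const_pos: "0 < s \<Longrightarrow> 0 < moment_const s"
  unfolding moment_const_def by (intro mult_pos_pos zero_less_power add_pos_nonneg jump_const_pos) auto

text \<open>Sum over the levels nA + C. As n + 1 \<le> 2^n, the fourth power of the next level is at
  most (A + C)^4 16^n, and the decay 32^(-n) leaves the series of 2^(-n) with sum 2. The part below
  C adds at most one more (A + C)^4, whence the factor 3 in \<open>moment_const\<close>.\<close>

lemma (in bounded_riesz) nn_integral_riesz_max_pow4:
  "(\<integral>\<^sup>+x. (riesz_max M s x) ^ 4 \<partial>M) \<le> ennreal (moment_const s) * emeasure M UNIV"
proof -
  define A C where "A = jump_const s" and "C = 20 powr s"
  have A: "0 < A" unfolding A_def by (rule jump_const_pos[OF s_pos])
  have C: "0 < C" by (simp add: C_def)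
  define S where "S = (\<lambda>n. {x. ennreal (real n * A + C) < riesz_max M s x})"
  have S [measurable]: "S n \<in> sets M" for n
    unfolding sets_M S_def by measurable
  have decay: "emeasure M (S n) \<le> ennreal ((1 / 32) ^ n) * emeasure M UNIV" for n
    unfolding S_def A_def C_def by (rule emeasure_riesz_max_decay)
  define w where "w = (\<lambda>n. (real (Suc n) * A + C) ^ 4)"
  have w: "0 \<le> w n" "w n \<le> (A + C) ^ 4 * 16 ^ n" for n
  proof -
    show "0 \<le> w n" using A C by (simp add: w_def)
    have "Suc n \<le> 2 ^ n" by (rule Suc_leI) simp
    then have n: "real (Suc n) \<le> 2 ^ n" by (metis of_nat_le_iff of_nat_numeral of_nat_power)
    have "real (Suc n) * A + C \<le> 2 ^ n * A + 2 ^ n * C"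
      using n A C by (intro add_mono mult_right_mono) auto
    then have "w n \<le> (2 ^ n * (A + C)) ^ 4"
      unfolding w_def using A C by (intro power_mono) (auto simp: algebra_simps)
    also have "\<dots> = (A + C) ^ 4 * 16 ^ n"
    proof -
      have "((2::real) ^ n) ^ 4 = (2 ^ 4) ^ n" by (simp only: power_mult[symmetric] mult.commute)
      then show ?thesis by (simp add: power_mult_distrib)
    qed
    finally show "w n \<le> (A + C) ^ 4 * 16 ^ n" .
  qed
  \<comment> \<open>An infinite value is not caught between two levels. It belongs to every
    \<open>S n\<close>, so the decay makes the set of such points null.\<close>
  have fin: "AE x in M. riesz_max M s x < \<infinity>"
  proof (rule AE_I)
    let ?N = "{x \<in> space M. \<not> riesz_max M s x < \<infinity>}"
    show "?N \<in> sets M" unfolding sets_M space_M by measurable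
    have "?N \<subseteq> S n" for n by (auto simp: S_def top.not_eq_extremum[symmetric] not_less)
    then have "emeasure M ?N \<le> emeasure M (S n)" for n by (intro emeasure_mono S)
    then have "emeasure M ?N \<le> ennreal ((1 / 32) ^ n) * emeasure M UNIV" for n
      using decay by (rule order_trans)
    then have "measure M ?N \<le> (1 / 32) ^ n * measure M UNIV" for n
      by (simp only: emeasure_eq_measure ennreal_mult'[symmetric] zero_le_power
          zero_le_divide_1_iff zero_le_numeral ennreal_le_iff measure_nonneg mult_nonneg_nonneg)
    moreover have "(\<lambda>n. (1 / 32) ^ n * measure M UNIV) \<longlonglongrightarrow> 0 * measure M UNIV"
      by (intro tendsto_mult LIMSEQ_power_zero tendsto_const) simp
    ultimately have "measure M ?N \<le> 0"
      by (intro LIMSEQ_le_const[of _ 0]) auto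
    then show "emeasure M ?N = 0" by (simp add: emeasure_eq_measure measure_le_0_iff)
  qed auto
  have "(\<integral>\<^sup>+x. (riesz_max M s x) ^ 4 \<partial>M)
      \<le> (\<integral>\<^sup>+x. ennreal (C ^ 4) + (\<Sum>n. ennreal (w n) * indicator (S n) x) \<partial>M)"
  proof (rule nn_integral_mono_AE, use fin in eventually_elim)
    fix x assume "riesz_max M s x < \<infinity>"
    then obtain v where v: "0 \<le> v" "riesz_max M s x = ennreal v" by (cases "riesz_max M s x") auto
    show "(riesz_max M s x) ^ 4 \<le> ennreal (C ^ 4) + (\<Sum>n. ennreal (w n) * indicator (S n) x)"
    proof (cases "v \<le> C")
      case True
      then have "(riesz_max M s x) ^ 4 \<le> ennreal (C ^ 4)"
        using v by (simp add: ennreal_power ennreal_leI power_mono)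
      then show ?thesis by (simp add: add_increasing2)
    next
      case False
      \<comment> \<open>Rounding up and subtracting 1 makes the lower inequality strict, as
        membership in \<open>S n\<close> requires, and the upper one non-strict.\<close>
      define n where "n = nat (\<lceil>(v - C) / A\<rceil> - 1)"
      have "0 < (v - C) / A" using False A by simp
      then have "real n < (v - C) / A" "(v - C) / A \<le> real (Suc n)"
        unfolding n_def by linarith+
      then have n: "real n * A + C < v" "v \<le> real (Suc n) * A + C"
        using A by (simp_all add: field_simps)
      have "x \<in> S n"
      proof -
        have "0 \<le> real n * A + C" using A C by simp
        then show ?thesis using n(1) v by (simp only: S_def mem_Collect_eq ennreal_less_iff)
      qed
      have "(riesz_max M s x) ^ 4 \<le> ennreal (w n)"
        using v n(2) unfolding w_def by (simp only: ennreal_power) (intro ennreal_leI power_mono, auto)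
      also have "\<dots> = ennreal (w n) * indicator (S n) x"
        using \<open>x \<in> S n\<close> by simp
      also have "\<dots> \<le> (\<Sum>n. ennreal (w n) * indicator (S n) x)"
        by (rule suminf_ge_term)
      finally show ?thesis by (simp add: add_increasing)
    qed
  qed
  also have "\<dots> = ennreal (C ^ 4) * emeasure M UNIV + (\<integral>\<^sup>+x. (\<Sum>n. ennreal (w n) * indicator (S n) x) \<partial>M)"
    by (subst nn_integral_add) auto
  also have "(\<integral>\<^sup>+x. (\<Sum>n. ennreal (w n) * indicator (S n) x) \<partial>M)
      = (\<Sum>n. \<integral>\<^sup>+x. ennreal (w n) * indicator (S n) x \<partial>M)"
    by (rule nn_integral_suminf) auto
  also have "\<dots> \<le> (\<Sum>n. ennreal ((A + C) ^ 4 * measure M UNIV * (1 / 2) ^ n))"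
  proof (rule suminf_le)
    fix n
    have "(\<integral>\<^sup>+x. ennreal (w n) * indicator (S n) x \<partial>M) = ennreal (w n) * emeasure M (S n)"
      by (rule nn_integral_cmult_indicator) simp
    also have "\<dots> \<le> ennreal ((A + C) ^ 4 * 16 ^ n) * (ennreal ((1 / 32) ^ n) * emeasure M UNIV)"
      by (intro mult_mono ennreal_leI w decay) auto
    also have "\<dots> = ennreal ((A + C) ^ 4 * 16 ^ n * ((1 / 32) ^ n * measure M UNIV))"
      using A C by (simp only: emeasure_eq_measure ennreal_mult ennreal_mult' zero_le_power
          zero_le_mult_iff measure_nonneg zero_le_divide_1_iff zero_le_numeral simp_thms)
    also have "(A + C) ^ 4 * 16 ^ n * ((1 / 32) ^ n * measure M UNIV) = (A + C) ^ 4 * measure M UNIV * (1 / 2) ^ n"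
    proof -
      have "(16::real) ^ n * (1 / 32) ^ n = (1 / 2) ^ n" by (simp flip: power_mult_distrib)
      moreover have "(A + C) ^ 4 * 16 ^ n * ((1 / 32) ^ n * measure M UNIV)
          = (A + C) ^ 4 * measure M UNIV * (16 ^ n * (1 / 32) ^ n)"
        by (simp only: mult_ac)
      ultimately show ?thesis by (simp only:)
    qed
    finally show "(\<integral>\<^sup>+x. ennreal (w n) * indicator (S n) x \<partial>M)
        \<le> ennreal ((A + C) ^ 4 * measure M UNIV * (1 / 2) ^ n)" .
  qed auto
  also have "\<dots> = ennreal (2 * (A + C) ^ 4 * measure M UNIV)"
  proof (rule suminf_ennreal_eq)
    show "(\<lambda>n. (A + C) ^ 4 * measure M UNIV * (1 / 2) ^ n) sums (2 * (A + C) ^ 4 * measure M UNIV)"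
      using sums_mult[OF geometric_sums[of "1/2::real"], of "(A + C) ^ 4 * measure M UNIV"]
      by (simp add: mult_ac)
  qed (use A C in auto)
  also have "ennreal (C ^ 4) * emeasure M UNIV + ennreal (2 * (A + C) ^ 4 * measure M UNIV)
      = ennreal ((C ^ 4 + 2 * (A + C) ^ 4) * measure M UNIV)"
    using A C by (simp add: emeasure_eq_measure distrib_right flip: ennreal_plus ennreal_mult')
  also have "\<dots> \<le> ennreal (moment_const s * measure M UNIV)"
  proof (intro ennreal_leI mult_right_mono)
    have "C ^ 4 \<le> (A + C) ^ 4" using A C by (intro power_mono) auto
    then show "C ^ 4 + 2 * (A + C) ^ 4 \<le> moment_const s" by (simp add: moment_const_def flip: A_def C_def)
  qed simp
  also have "\<dots> = ennreal (moment_const s) * emeasure M UNIV"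
    using moment_const_pos[OF s_pos] by (simp add: emeasure_eq_measure ennreal_mult)
  finally show ?thesis by (simp add: add_left_mono)
qed

section \<open>Level sets\<close>

lemma ennreal_sqrt_le_1: "t \<le> 1 \<Longrightarrow> ennreal_sqrt t \<le> 1"
  by (cases t) (auto simp: ennreal_sqrt_def ennreal_le_1 top_unique)

lemma L2_norm_le_1_iff: "L2_norm M g \<le> 1 \<longleftrightarrow> (\<integral>\<^sup>+x. (g x)\<^sup>2 \<partial>M) \<le> 1"
proof
  assume "L2_norm M g \<le> 1"
  then have "(L2_norm M g)\<^sup>2 \<le> 1" by (simp add: power_le_one)
  then show "(\<integral>\<^sup>+x. (g x)\<^sup>2 \<partial>M) \<le> 1" by (simp add: L2_norm_power2)
qed (simp add: L2_norm_def ennreal_sqrt_le_1)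

text \<open>The operator is applied to the indicator of \<open>E\<close> divided by the square root
  of its mass, a function of norm 1, and homogeneity restores the factor. A null set cannot be
  normalised in this way, but its potentials vanish.\<close>

lemma (in growth_measure) bounded_riesz_of_norm_le_1:
  assumes "riesz_norm M s \<le> 1"
  shows "bounded_riesz M s"
proof
  fix \<epsilon> :: real and E :: "'a set"
  assume \<epsilon>: "0 < \<epsilon>" and E [measurable]: "E \<in> sets borel"
  let ?I = "\<integral>\<^sup>+x. (ennreal (norm (riesz_pot M s (E - cball x \<epsilon>) x)))\<^sup>2 \<partial>M"
  define m where "m = measure M E"
  show "?I \<le> emeasure M E"
  proof (cases "m = 0")
    case True
    have "norm (riesz_pot M s (E - cball x \<epsilon>) x) \<le> 0" for x
    proof -
      have "norm (riesz_pot M s (E - cball x \<epsilon>) x) \<le> measure M (E - cball x \<epsilon>) * \<epsilon> powr (- s)"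
        by (rule norm_riesz_pot_le) (use \<epsilon> in auto)
      also have "measure M (E - cball x \<epsilon>) \<le> m"
        unfolding m_def by (intro finite_measure_mono) (auto simp: sets_M)
      finally show ?thesis using True by (simp add: mult_right_mono)
    qed
    then show ?thesis by simp
  next
    case False
    then have m: "0 < m" by (simp add: m_def zero_less_measure_iff)
    define a where "a = 1 / sqrt m"
    have a: "0 < a" "a\<^sup>2 = 1 / m" using m by (auto simp: a_def power_divide)
    let ?f = "\<lambda>y. a * indicator E y :: real"
    have "(\<integral>\<^sup>+x. (ennreal \<bar>?f x\<bar>)\<^sup>2 \<partial>M) = (\<integral>\<^sup>+x. ennreal (1 / m) * indicator E x \<partial>M)"
      using a by (intro nn_integral_cong) (auto simp: ennreal_power split: split_indicator)
    also have "\<dots> = ennreal (1 / m) * emeasure M E"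
      by (rule nn_integral_cmult_indicator) (simp add: sets_M)
    also have "\<dots> = 1"
      using m by (simp add: emeasure_eq_measure flip: m_def ennreal_mult')
    finally have f: "L2_norm M (\<lambda>x. ennreal \<bar>?f x\<bar>) \<le> 1" by (simp add: L2_norm_le_1_iff)
    have "L2_norm M (\<lambda>x. ennreal (norm (riesz_trunc_op M s \<epsilon> ?f x))) \<le> L2_op_norm M (riesz_trunc_op M s \<epsilon>)"
      unfolding L2_op_norm_def by (rule SUP_upper) (use f in auto)
    also have "\<dots> \<le> riesz_norm M s"
      unfolding riesz_norm_def by (rule SUP_upper) (use \<epsilon> in auto)
    also have "\<dots> \<le> 1" by fact
    finally have "(\<integral>\<^sup>+x. (ennreal (norm (riesz_trunc_op M s \<epsilon> ?f x)))\<^sup>2 \<partial>M) \<le> 1"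
      by (simp only: L2_norm_le_1_iff)
    also have "(\<lambda>x. (ennreal (norm (riesz_trunc_op M s \<epsilon> ?f x)))\<^sup>2)
        = (\<lambda>x. ennreal (1 / m) * (ennreal (norm (riesz_pot M s (E - cball x \<epsilon>) x)))\<^sup>2)"
      using a m by (intro ext)
        (simp add: riesz_trunc_op_indicator ennreal_power power_mult_distrib flip: ennreal_mult)
    also have "(\<integral>\<^sup>+x. ennreal (1 / m) * (ennreal (norm (riesz_pot M s (E - cball x \<epsilon>) x)))\<^sup>2 \<partial>M)
        = ennreal (1 / m) * ?I"
      by (rule nn_integral_cmult) measurable
    finally have "ennreal m * (ennreal (1 / m) * ?I) \<le> ennreal m * 1"
      by (rule mult_left_mono) simp
    then show ?thesis
      using m by (simp add: mult.assoc[symmetric] emeasure_eq_measure flip: ennreal_mult' m_def)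
  qed
qed

section \<open>Level sets and moments\<close>

lemma ennreal_threshold_AMGM:
  fixes v :: ennreal
  assumes "0 < b" "0 < \<tau>"
  shows "v \<le> ennreal b + ennreal (\<tau> / 2) * v\<^sup>2 + ennreal (1 / (2 * \<tau>)) * (if ennreal b < v then 1 else 0)"
proof (cases "ennreal b < v")
  case True
  show ?thesis
  proof (cases v)
    case (real r)
    \<comment> \<open>Young's inequality for \<tau> r and 1; it stands in for the Cauchy-Schwarz
      inequality on the level set.\<close>
    have "0 \<le> (\<tau> * r - 1)\<^sup>2" by simp
    then have "2 * \<tau> * r \<le> (\<tau> * r)\<^sup>2 + 1" by (simp add: power2_diff)
    then have "r \<le> \<tau> / 2 * r\<^sup>2 + 1 / (2 * \<tau>)"
      using assms by (simp add: field_simps power2_eq_square)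
    then have "ennreal r \<le> ennreal (b + \<tau> / 2 * r\<^sup>2 + 1 / (2 * \<tau>))"
      using assms by (intro ennreal_leI) auto
    then show ?thesis
      using True real assms by (simp add: ennreal_power flip: ennreal_plus ennreal_mult)
  next
    \<comment> \<open>The quadratic term alone is infinite, since \<tau> > 0.\<close>
    case top
    then show ?thesis using assms True by (simp add: ennreal_mult_top power2_eq_square)
  qed
next
  case False
  then show ?thesis by (auto simp: not_less intro: add_increasing2)
qed

text \<open>A Paley-Zygmund inequality. With \<tau> = (a - b) / C the quadratic term costs exactly
  half of the gap (a - b) m, where m is the total mass; the other half must come from the level
  set.\<close>

lemma (in finite_measure) level_set_lower_bound:
  assumes F [measurable]: "F \<in> borel_measurable M"
    and C: "0 < C" "(\<integral>\<^sup>+x. (F x)\<^sup>2 \<partial>M) \<le> ennreal C * emeasure M (space M)"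
    and low: "ennreal a * emeasure M (space M) \<le> (\<integral>\<^sup>+x. F x \<partial>M)"
    and b: "0 < b" "b < a"
  shows "(a - b)\<^sup>2 / C * measure M (space M) \<le> measure M {x \<in> space M. ennreal b < F x}"
proof -
  define m e \<tau> where "m = measure M (space M)" and "e = measure M {x \<in> space M. ennreal b < F x}"
    and "\<tau> = (a - b) / C"
  have \<tau>: "0 < \<tau>" using b C by (simp add: \<tau>_def)
  have nn: "0 \<le> m" "0 \<le> e" by (simp_all add: m_def e_def)
  let ?A = "{x \<in> space M. ennreal b < F x}"
  have "ennreal a * emeasure M (space M) \<le> (\<integral>\<^sup>+x. F x \<partial>M)" by fact
  also have "\<dots> \<le> (\<integral>\<^sup>+x. ennreal b + ennreal (\<tau> / 2) * (F x)\<^sup>2 + ennreal (1 / (2 * \<tau>)) * indicator ?A x \<partial>M)"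
  proof (rule nn_integral_mono)
    fix x assume "x \<in> space M"
    then show "F x \<le> ennreal b + ennreal (\<tau> / 2) * (F x)\<^sup>2 + ennreal (1 / (2 * \<tau>)) * indicator ?A x"
      using ennreal_threshold_AMGM[OF b(1) \<tau>, of "F x"] by (cases "ennreal b < F x") simp_all
  qed
  also have "\<dots> = ennreal b * emeasure M (space M) + ennreal (\<tau> / 2) * (\<integral>\<^sup>+x. (F x)\<^sup>2 \<partial>M)
      + ennreal (1 / (2 * \<tau>)) * emeasure M ?A"
    by (subst nn_integral_add, measurable, subst nn_integral_add, measurable)
       (simp add: nn_integral_cmult nn_integral_cmult_indicator)
  also have "\<dots> \<le> ennreal b * emeasure M (space M) + ennreal (\<tau> / 2) * (ennreal C * emeasure M (space M))
      + ennreal (1 / (2 * \<tau>)) * emeasure M ?A"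
    using C(2) by (intro add_mono mult_left_mono) auto
  also have "\<dots> = ennreal (b * m + \<tau> / 2 * (C * m) + 1 / (2 * \<tau>) * e)"
  proof -
    have "0 \<le> b" "0 \<le> C" "0 \<le> \<tau> / 2" "0 \<le> 1 / (2 * \<tau>)" using b C \<tau> by simp_all
    with nn show ?thesis
      by (simp only: emeasure_eq_measure m_def[symmetric] e_def[symmetric] ennreal_plus ennreal_mult
          add_nonneg_nonneg mult_nonneg_nonneg)
  qed
  finally have "ennreal (a * m) \<le> ennreal (b * m + \<tau> / 2 * (C * m) + 1 / (2 * \<tau>) * e)"
    using b nn by (simp add: emeasure_eq_measure ennreal_mult flip: m_def)
  then have "a * m \<le> b * m + \<tau> / 2 * (C * m) + 1 / (2 * \<tau>) * e"
    using b C \<tau> nn by (subst (asm) ennreal_le_iff) auto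
  moreover define X Y where "X = (a - b) * m" and "Y = C * e / (a - b)"
  have "\<tau> / 2 * (C * m) = X / 2" "1 / (2 * \<tau>) * e = Y / 2" "a * m = b * m + X"
    using C(1) by (simp_all add: \<tau>_def X_def Y_def field_simps)
  ultimately have "b * m + X \<le> b * m + X / 2 + Y / 2" by (simp only:)
  then have "X \<le> Y" by linarith
  then have "(a - b)\<^sup>2 * m \<le> C * e"
    using b by (simp add: X_def Y_def field_simps power2_eq_square)
  then show ?thesis using C by (simp add: field_simps flip: m_def e_def)
qed

text \<open>\<open>F\<close> is not assumed measurable: a level set of positive outcome under
  \<open>emeasure\<close> is automatically measurable, because \<open>emeasure\<close> is 0 on
  non-measurable sets.\<close>

lemma nn_integral_ge_level_set:
  assumes "t < emeasure M {x. ennreal b < F x}"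
  shows "ennreal b * t \<le> (\<integral>\<^sup>+x. F x \<partial>M)"
proof -
  have "{x. ennreal b < F x} \<in> sets M"
    using assms emeasure_notin_sets by fastforce
  then have "ennreal b * emeasure M {x. ennreal b < F x} = (\<integral>\<^sup>+x. ennreal b * indicator {x. ennreal b < F x} x \<partial>M)"
    by (simp add: nn_integral_cmult_indicator)
  also have "\<dots> \<le> (\<integral>\<^sup>+x. F x \<partial>M)"
    by (intro nn_integral_mono) (auto split: split_indicator)
  finally show ?thesis
    using assms by (meson less_imp_le mult_left_mono order_trans zero_le)
qed

text \<open>Positive mass is assumed in the direct parts because for the zero measure their strict
  conclusion would read 0 > 0.\<close>

theorem theorem2p1:
  fixes s :: real
  assumes "s > 0"
  shows "\<exists>c::real. c > 0 \<and>
    (\<forall>\<eta> :: (real ^ 'd::finite) measure.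
       \<eta> \<in> growth_class s \<and> emeasure \<eta> UNIV < \<infinity> \<and>
       (AE x in \<eta>. riesz_exists \<eta> s x) \<and> riesz_norm \<eta> s \<le> 1 \<longrightarrow>
       (\<forall>a>0. emeasure \<eta> UNIV > 0 \<and>
          (L2_norm \<eta> (\<lambda>x. ennreal (norm (riesz \<eta> s x))))\<^sup>2 \<ge> ennreal a * emeasure \<eta> UNIV \<longrightarrow>
          (\<forall>b\<in>{0<..<a}.
             emeasure \<eta> {x. (norm (riesz \<eta> s x))\<^sup>2 > b} > ennreal (c * (a - b)\<^sup>2) * emeasure \<eta> UNIV)) \<and>
       (\<forall>a b. 0 < b \<and> b < a \<and>
          emeasure \<eta> {x. (norm (riesz \<eta> s x))\<^sup>2 > b} > ennreal (c * (a - b)\<^sup>2) * emeasure \<eta> UNIV \<longrightarrow>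
          (L2_norm \<eta> (\<lambda>x. ennreal (norm (riesz \<eta> s x))))\<^sup>2
            \<ge> ennreal (b * c * (a - b)\<^sup>2) * emeasure \<eta> UNIV) \<and>
       (\<forall>a>0. emeasure \<eta> UNIV > 0 \<and>
          (L2_norm \<eta> (riesz_max \<eta> s))\<^sup>2 \<ge> ennreal a * emeasure \<eta> UNIV \<longrightarrow>
          (\<forall>b\<in>{0<..<a}.
             emeasure \<eta> {x. (riesz_max \<eta> s x)\<^sup>2 > ennreal b} > ennreal (c * (a - b)\<^sup>2) * emeasure \<eta> UNIV)) \<and>
       (\<forall>a b. 0 < b \<and> b < a \<and>
          emeasure \<eta> {x. (riesz_max \<eta> s x)\<^sup>2 > ennreal b} > ennreal (c * (a - b)\<^sup>2) * emeasure \<eta> UNIV \<longrightarrow>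
          (L2_norm \<eta> (riesz_max \<eta> s))\<^sup>2
            \<ge> ennreal (b * c * (a - b)\<^sup>2) * emeasure \<eta> UNIV))"
proof (intro exI[of _ "1 / (2 * moment_const s)"] conjI allI impI ballI)
  show "0 < 1 / (2 * moment_const s)"
    using moment_const_pos[OF assms] by simp
next
  fix \<eta> :: "(real ^ 'd) measure"
  assume "\<eta> \<in> growth_class s \<and> emeasure \<eta> UNIV < \<infinity> \<and>
       (AE x in \<eta>. riesz_exists \<eta> s x) \<and> riesz_norm \<eta> s \<le> 1"
  then have sets: "sets \<eta> = sets borel"
    and growth: "\<And>x r. 0 < r \<Longrightarrow> emeasure \<eta> (ball x r) \<le> ennreal (r powr s)"
    and fin: "emeasure \<eta> UNIV < \<infinity>" and ex: "AE x in \<eta>. riesz_exists \<eta> s x"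
    and bnd: "riesz_norm \<eta> s \<le> 1"
    by (auto simp: growth_class_def)
  have space: "space \<eta> = UNIV" using sets_eq_imp_space_eq[OF sets] by simp
  interpret finite_measure \<eta>
    by (rule finite_measureI) (use fin space in auto)
  interpret growth_measure \<eta> s
  proof
    show "measure \<eta> (ball x r) \<le> r powr s" if "0 < r" for x r
      using growth[OF that, of x] by (simp add: emeasure_eq_measure)
  qed (use assms sets in auto)
  interpret bounded_riesz \<eta> s
    by (rule bounded_riesz_of_norm_le_1[OF bnd])
  define C where "C = moment_const s"
  have C: "0 < C" unfolding C_def by (rule moment_const_pos[OF assms])
  let ?c = "1 / (2 * C)"
  let ?R = "\<lambda>x. (riesz_max \<eta> s x)\<^sup>2" and ?P = "\<lambda>x. (ennreal (norm (riesz \<eta> s x)))\<^sup>2"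
  have R4: "(\<integral>\<^sup>+x. (?R x)\<^sup>2 \<partial>\<eta>) \<le> ennreal C * emeasure \<eta> UNIV"
    using nn_integral_riesz_max_pow4 by (simp add: C_def flip: power_mult)
  have P4: "(\<integral>\<^sup>+x. (?P x)\<^sup>2 \<partial>\<eta>) \<le> ennreal C * emeasure \<eta> UNIV"
  proof (rule order_trans[OF nn_integral_mono_AE R4])
    show "AE x in \<eta>. (?P x)\<^sup>2 \<le> (?R x)\<^sup>2"
      using ex by eventually_elim (intro power_mono norm_riesz_le_riesz_max, auto)
  qed
  have P_level: "{x. b < (norm (riesz \<eta> s x))\<^sup>2} = {x. ennreal b < ?P x}" if "0 < b" for b
    using that by (simp add: ennreal_power ennreal_less_iff)
  have direct: "ennreal (?c * (a - b)\<^sup>2) * emeasure \<eta> UNIV < emeasure \<eta> {x. ennreal b < F x}"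
    if F: "F \<in> borel_measurable borel" "(\<integral>\<^sup>+x. (F x)\<^sup>2 \<partial>\<eta>) \<le> ennreal C * emeasure \<eta> UNIV"
      and pos: "0 < emeasure \<eta> UNIV" and low: "ennreal a * emeasure \<eta> UNIV \<le> (\<integral>\<^sup>+x. F x \<partial>\<eta>)"
      and b: "0 < b" "b < a" for F a b
  proof -
    have m: "0 < measure \<eta> UNIV" using pos by (simp add: emeasure_eq_measure)
    have "F \<in> borel_measurable \<eta>" using F(1) by measurable
    then have "(a - b)\<^sup>2 / C * measure \<eta> UNIV \<le> measure \<eta> {x. ennreal b < F x}"
      using level_set_lower_bound[of F C a b] F(2) C low b by simp
    \<comment> \<open>\<open>?c\<close> is half of the constant just obtained; together with
      positive mass this gives strictness.\<close>
    moreover have "?c * (a - b)\<^sup>2 * measure \<eta> UNIV < (a - b)\<^sup>2 / C * measure \<eta> UNIV"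
      using b C m by (intro mult_strict_right_mono) (auto simp: field_simps)
    ultimately show ?thesis
      using C by (simp add: emeasure_eq_measure ennreal_less_iff flip: ennreal_mult')
  qed
  have converse: "ennreal (b * ?c * (a - b)\<^sup>2) * emeasure \<eta> UNIV \<le> (\<integral>\<^sup>+x. F x \<partial>\<eta>)"
    if "0 < b" "ennreal (?c * (a - b)\<^sup>2) * emeasure \<eta> UNIV < emeasure \<eta> {x. ennreal b < F x}" for F a b
  proof -
    have "ennreal (b * ?c * (a - b)\<^sup>2) = ennreal b * ennreal (?c * (a - b)\<^sup>2)"
      using that(1) by (simp only: mult.assoc ennreal_mult' less_imp_le)
    then show ?thesis
      using nn_integral_ge_level_set[OF that(2)] by (simp only: mult.assoc)
  qed
  show "ennreal (1 / (2 * moment_const s) * (a - b)\<^sup>2) * emeasure \<eta> UNIV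
      < emeasure \<eta> {x. b < (norm (riesz \<eta> s x))\<^sup>2}"
    if "0 < emeasure \<eta> UNIV \<and>
      ennreal a * emeasure \<eta> UNIV \<le> (L2_norm \<eta> (\<lambda>x. ennreal (norm (riesz \<eta> s x))))\<^sup>2"
      "b \<in> {0<..<a}" for a b
    using that direct[of ?P a b] P4 P_level[of b] by (simp add: L2_norm_power2 C_def)
  show "ennreal (b * (1 / (2 * moment_const s)) * (a - b)\<^sup>2) * emeasure \<eta> UNIV
      \<le> (L2_norm \<eta> (\<lambda>x. ennreal (norm (riesz \<eta> s x))))\<^sup>2"
    if "0 < b \<and> b < a \<and> ennreal (1 / (2 * moment_const s) * (a - b)\<^sup>2) * emeasure \<eta> UNIV
      < emeasure \<eta> {x. b < (norm (riesz \<eta> s x))\<^sup>2}" for a b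
    using that converse[of b a ?P] P_level[of b] by (simp add: L2_norm_power2 C_def)
  show "ennreal (1 / (2 * moment_const s) * (a - b)\<^sup>2) * emeasure \<eta> UNIV
      < emeasure \<eta> {x. ennreal b < ?R x}"
    if "0 < emeasure \<eta> UNIV \<and> ennreal a * emeasure \<eta> UNIV \<le> (L2_norm \<eta> (riesz_max \<eta> s))\<^sup>2"
      "b \<in> {0<..<a}" for a b
    using that direct[of ?R a b] R4 by (simp add: L2_norm_power2 C_def)
  show "ennreal (b * (1 / (2 * moment_const s)) * (a - b)\<^sup>2) * emeasure \<eta> UNIV
      \<le> (L2_norm \<eta> (riesz_max \<eta> s))\<^sup>2"
    if "0 < b \<and> b < a \<and> ennreal (1 / (2 * moment_const s) * (a - b)\<^sup>2) * emeasure \<eta> UNIV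
      < emeasure \<eta> {x. ennreal b < ?R x}" for a b
    using that converse[of b a ?R] by (simp add: L2_norm_power2 C_def)
qed

end
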